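(* Consider $1:1$-fair $k$-center with outliers on a finite metric space $(P,d)$ with $P=H_1\cupdot H_2$, $|P|=n$ and $|H_2|\ge|H_1|$. For any $z\ge|H_2|-|H_1|$ there exists an $11$-approximation algorithm for $1:1$-fair $k$-center with $z$ outliers from $H_1\cup H_2$ that runs in time $O(n^5)$.
   Context: A $1:1$-fair $k$-clustering with $z$ outliers is a set $C\subseteq P$ of at most $k$ centers together with a map $\alpha:P\to C\cup\{\perp\}$ such that $Z=\alpha^{-1}(\perp)$ (the outliers, which may belong to either color class) has $|Z|\le z$ and every cluster $\alpha^{-1}(c)$, $c\in C$, satisfies $|\alpha^{-1}(c)\cap H_1|=|\alpha^{-1}(c)\cap H_2|$. A center need not be assigned to itself and may itself be an outlier. The cost is $\max_{x\in P\setminus Z}d(x,\alpha(x))$. An $11$-approximation algorithm outputs a feasible solution (at most $z$ outliers) of cost at most $11$ times the minimum cost over all feasible solutions. Here $z$ and $k$ are part of the input. *)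

theory Defs
  imports "HOL-Analysis.Analysis" "HOL-Library.Landau_Symbols"
begin

section \<open>1:1-fair k-center with outliers\<close>

text \<open>A clustering is a set \<open>C\<close> of centers with an assignment \<open>\<alpha>\<close>, of which only the values on
  \<open>P\<close> matter; \<open>None\<close> plays the role of \<open>\<bottom>\<close>, so \<open>\<alpha> x = None\<close> says that \<open>x\<close> is an outlier.\<close>

definition outliers :: "'a set \<Rightarrow> ('a \<Rightarrow> 'a option) \<Rightarrow> 'a set" where
  "outliers P \<alpha> = {x \<in> P. \<alpha> x = None}"

definition cluster :: "'a set \<Rightarrow> ('a \<Rightarrow> 'a option) \<Rightarrow> 'a \<Rightarrow> 'a set" where
  "cluster P \<alpha> c = {x \<in> P. \<alpha> x = Some c}"

definition fair_clustering ::
  "'a set \<Rightarrow> 'a set \<Rightarrow> 'a set \<Rightarrow> nat \<Rightarrow> nat \<Rightarrow> 'a set \<Rightarrow> ('a \<Rightarrow> 'a option) \<Rightarrow> bool" where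
  "fair_clustering P H1 H2 k z C \<alpha> \<longleftrightarrow>
     C \<subseteq> P \<and> card C \<le> k \<and> \<alpha> ` P \<subseteq> insert None (Some ` C) \<and>
     card (outliers P \<alpha>) \<le> z \<and>
     (\<forall>c\<in>C. card (cluster P \<alpha> c \<inter> H1) = card (cluster P \<alpha> c \<inter> H2))"

text \<open>Inserting \<open>0\<close> only matters if every point is an outlier (distances are nonnegative); the cost
  is then \<open>0\<close>.\<close>

definition clustering_cost :: "'a set \<Rightarrow> ('a \<Rightarrow> 'a \<Rightarrow> real) \<Rightarrow> ('a \<Rightarrow> 'a option) \<Rightarrow> real" where
  "clustering_cost P d \<alpha> = Max (insert 0 ((\<lambda>x. d x (the (\<alpha> x))) ` (P - outliers P \<alpha>)))"

definition feasible_costs ::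
  "'a set \<Rightarrow> ('a \<Rightarrow> 'a \<Rightarrow> real) \<Rightarrow> 'a set \<Rightarrow> 'a set \<Rightarrow> nat \<Rightarrow> nat \<Rightarrow> real set" where
  "feasible_costs P d H1 H2 k z =
     {clustering_cost P d \<alpha> |C \<alpha>. fair_clustering P H1 H2 k z C \<alpha>}"

definition opt_cost ::
  "'a set \<Rightarrow> ('a \<Rightarrow> 'a \<Rightarrow> real) \<Rightarrow> 'a set \<Rightarrow> 'a set \<Rightarrow> nat \<Rightarrow> nat \<Rightarrow> real" where
  "opt_cost P d H1 H2 k z = Min (feasible_costs P d H1 H2 k z)"

lemma finite_feasible_costs:
  assumes "finite P"
  shows "finite (feasible_costs P d H1 H2 k z)"
proof (rule finite_subset)
  let ?D = "(\<lambda>(x, y). d x y) ` (P \<times> P)"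
  show "feasible_costs P d H1 H2 k z \<subseteq> insert 0 ?D"
  proof
    fix v assume "v \<in> feasible_costs P d H1 H2 k z"
    then obtain C \<alpha> where v: "v = clustering_cost P d \<alpha>" and f: "fair_clustering P H1 H2 k z C \<alpha>"
      by (auto simp: feasible_costs_def)
    let ?S = "(\<lambda>x. d x (the (\<alpha> x))) ` (P - outliers P \<alpha>)"
    have "v \<in> insert 0 ?S"
      unfolding v clustering_cost_def using assms by (intro Max_in) auto
    moreover have "?S \<subseteq> ?D"
    proof
      fix w assume "w \<in> ?S"
      then obtain x where "x \<in> P - outliers P \<alpha>" and w: "w = d x (the (\<alpha> x))"
        by blast
      then have x: "x \<in> P" "\<alpha> x \<noteq> None" by (auto simp: outliers_def)
      have "\<alpha> x \<in> insert None (Some ` C)" "C \<subseteq> P"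
        using f x(1) by (auto simp: fair_clustering_def)
      then have "the (\<alpha> x) \<in> P" using x(2) by auto
      then show "w \<in> ?D" using x w by force
    qed
    ultimately show "v \<in> insert 0 ?D" by blast
  qed
  show "finite (insert 0 ?D)" using assms by auto
qed

text \<open>With at least one center, \<open>z \<ge> |H2| - |H1|\<close> makes every instance feasible.\<close>

lemma fair_clustering_exists:
  assumes "finite P" "P = H1 \<union> H2" "H1 \<inter> H2 = {}"
    and le: "card H1 \<le> card H2" and z: "card H2 - card H1 \<le> z" and "k \<ge> 1"
  shows "\<exists>C \<alpha>. fair_clustering P H1 H2 k z C \<alpha>"
proof (cases "P = {}")
  case True
  then show ?thesis
    by (intro exI[of _ "{}"] exI[of _ "\<lambda>_. None"]) (auto simp: fair_clustering_def outliers_def)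
next
  case False
  then obtain p where p: "p \<in> P" by blast
  have fin: "finite H1" "finite H2" using assms by auto
  obtain S where S: "S \<subseteq> H2" "card S = card H1"
    by (rule obtain_subset_with_card_n[OF le])
  define \<alpha> where "\<alpha> x = (if x \<in> H1 \<union> S then Some p else None)" for x
  have "outliers P \<alpha> = H2 - S"
    using assms(2,3) S by (auto simp: outliers_def \<alpha>_def)
  moreover have "card (H2 - S) \<le> z"
    using S fin z by (simp add: card_Diff_subset finite_subset)
  moreover have "cluster P \<alpha> p \<inter> H1 = H1" "cluster P \<alpha> p \<inter> H2 = S"
    using assms(2,3) S by (auto simp: cluster_def \<alpha>_def)
  ultimately have "fair_clustering P H1 H2 k z {p} \<alpha>"
    using p S \<open>k \<ge> 1\<close> by (auto simp: fair_clustering_def \<alpha>_def)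
  then show ?thesis by blast
qed

section \<open>The machine model\<close>

text \<open>Programs run on a unit-cost random access machine with a memory of natural numbers and a
  memory of reals. Each memory is divided into named arrays; a scalar variable \<open>v\<close> is the cell
  \<open>v[0]\<close>. The distance matrix is read-only and addressed by the indices of two points. Naturals
  support addition, truncated subtraction and comparison; reals support addition, subtraction and
  comparison, and cannot be converted to naturals. Every executed command and every node of an
  evaluated expression costs one step (sequential composition itself is free).\<close>

datatype nexp =
    Const nat
  | Read string nexp
  | Plus nexp nexp
  | Minus nexp nexp

datatype rexp =
    Dist nexp nexp
  | ReadR string nexp
  | PlusR rexp rexp
  | MinusR rexp rexp

datatype test =
    Less nexp nexp
  | LessR rexp rexp
  | Not test
  | And test test

datatype com =
    Skip
  | Write string nexp nexp    \<comment> \<open>\<open>Write v i e\<close> is \<open>v[i] := e\<close>\<close>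
  | WriteR string nexp rexp
  | Seq com com
  | Cond test com com
  | Loop test com

type_synonym nmem = "string \<Rightarrow> nat \<Rightarrow> nat"
type_synonym rmem = "string \<Rightarrow> nat \<Rightarrow> real"
type_synonym state = "nmem \<times> rmem"

fun nval :: "nexp \<Rightarrow> state \<Rightarrow> nat" where
  "nval (Const m) s = m"
| "nval (Read v i) s = fst s v (nval i s)"
| "nval (Plus a b) s = nval a s + nval b s"
| "nval (Minus a b) s = nval a s - nval b s"

fun rval :: "(nat \<Rightarrow> nat \<Rightarrow> real) \<Rightarrow> rexp \<Rightarrow> state \<Rightarrow> real" where
  "rval D (Dist i j) s = D (nval i s) (nval j s)"
| "rval D (ReadR v i) s = snd s v (nval i s)"
| "rval D (PlusR a b) s = rval D a s + rval D b s"
| "rval D (MinusR a b) s = rval D a s - rval D b s"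

fun tval :: "(nat \<Rightarrow> nat \<Rightarrow> real) \<Rightarrow> test \<Rightarrow> state \<Rightarrow> bool" where
  "tval D (Less a b) s \<longleftrightarrow> nval a s < nval b s"
| "tval D (LessR a b) s \<longleftrightarrow> rval D a s < rval D b s"
| "tval D (Not b) s \<longleftrightarrow> \<not> tval D b s"
| "tval D (And b c) s \<longleftrightarrow> tval D b s \<and> tval D c s"

fun ntime :: "nexp \<Rightarrow> nat" where
  "ntime (Const m) = 1"
| "ntime (Read v i) = 1 + ntime i"
| "ntime (Plus a b) = 1 + ntime a + ntime b"
| "ntime (Minus a b) = 1 + ntime a + ntime b"

fun rtime :: "rexp \<Rightarrow> nat" where
  "rtime (Dist i j) = 1 + ntime i + ntime j"
| "rtime (ReadR v i) = 1 + ntime i"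
| "rtime (PlusR a b) = 1 + rtime a + rtime b"
| "rtime (MinusR a b) = 1 + rtime a + rtime b"

fun ttime :: "test \<Rightarrow> nat" where
  "ttime (Less a b) = 1 + ntime a + ntime b"
| "ttime (LessR a b) = 1 + rtime a + rtime b"
| "ttime (Not b) = 1 + ttime b"
| "ttime (And b c) = 1 + ttime b + ttime c"

text \<open>\<open>exec D c s t s'\<close>: with distance matrix \<open>D\<close>, command \<open>c\<close> started in state \<open>s\<close> halts in state
  \<open>s'\<close> after exactly \<open>t\<close> steps.\<close>

inductive exec :: "(nat \<Rightarrow> nat \<Rightarrow> real) \<Rightarrow> com \<Rightarrow> state \<Rightarrow> nat \<Rightarrow> state \<Rightarrow> bool"
  for D :: "nat \<Rightarrow> nat \<Rightarrow> real" where
  Skip: "exec D Skip s 1 s"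
| Write: "exec D (Write v i e) s (1 + ntime i + ntime e)
     ((fst s)(v := (fst s v)(nval i s := nval e s)), snd s)"
| WriteR: "exec D (WriteR v i e) s (1 + ntime i + rtime e)
     (fst s, (snd s)(v := (snd s v)(nval i s := rval D e s)))"
| Seq: "exec D c s t s' \<Longrightarrow> exec D c' s' t' s'' \<Longrightarrow> exec D (Seq c c') s (t + t') s''"
| CondTrue: "tval D b s \<Longrightarrow> exec D c s t s' \<Longrightarrow> exec D (Cond b c c') s (1 + ttime b + t) s'"
| CondFalse: "\<not> tval D b s \<Longrightarrow> exec D c' s t s' \<Longrightarrow> exec D (Cond b c c') s (1 + ttime b + t) s'"
| LoopFalse: "\<not> tval D b s \<Longrightarrow> exec D (Loop b c) s (1 + ttime b) s"
| LoopTrue: "tval D b s \<Longrightarrow> exec D c s t s' \<Longrightarrow> exec D (Loop b c) s' t' s'' \<Longrightarrow>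
     exec D (Loop b c) s (1 + ttime b + t + t') s''"

inductive_cases SkipE: "exec D Skip s t s'"
inductive_cases WriteE: "exec D (Write v i e) s t s'"
inductive_cases WriteRE: "exec D (WriteR v i e) s t s'"
inductive_cases SeqE: "exec D (Seq c c') s t s'"
inductive_cases CondE: "exec D (Cond b c c') s t s'"
inductive_cases LoopE: "exec D (Loop b c) s t s'"

lemma exec_deterministic:
  "exec D c s t s' \<Longrightarrow> exec D c s u s'' \<Longrightarrow> u = t \<and> s'' = s'"
proof (induction arbitrary: u s'' rule: exec.induct)
  case (Seq c s t s1 c' t' s2)
  show ?case
  proof (rule SeqE[OF Seq.prems])
    fix v s1' v'
    assume u: "u = v + v'" and 1: "exec D c s v s1'" and 2: "exec D c' s1' v' s''"
    have "v = t \<and> s1' = s1" by (rule Seq.IH(1)[OF 1])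
    moreover from this have "v' = t' \<and> s'' = s2" using Seq.IH(2) 2 by blast
    ultimately show ?thesis using u by simp
  qed
next
  case (CondTrue b s c t s' c')
  show ?case
  proof (rule CondE[OF CondTrue.prems])
    fix v
    assume u: "u = Suc (ttime b + v)" and 1: "exec D c s v s''"
    show ?thesis using CondTrue.IH[OF 1] u by simp
  next
    assume "\<not> tval D b s"
    then show ?thesis using CondTrue.hyps by blast
  qed
next
  case (CondFalse b s c' t s' c)
  show ?case
  proof (rule CondE[OF CondFalse.prems])
    assume "tval D b s"
    then show ?thesis using CondFalse.hyps by blast
  next
    fix v
    assume u: "u = Suc (ttime b + v)" and 1: "exec D c' s v s''"
    show ?thesis using CondFalse.IH[OF 1] u by simp
  qed
next
  case (LoopFalse b s c)
  show ?case
  proof (rule LoopE[OF LoopFalse.prems])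
    assume "u = Suc (ttime b)" "s'' = s"
    then show ?thesis by simp
  next
    assume "tval D b s"
    then show ?thesis using LoopFalse.hyps by blast
  qed
next
  case (LoopTrue b s c t s1 t' s2)
  show ?case
  proof (rule LoopE[OF LoopTrue.prems])
    assume "\<not> tval D b s"
    then show ?thesis using LoopTrue.hyps by blast
  next
    fix v s1' v'
    assume u: "u = Suc (ttime b + v + v')" and 1: "exec D c s v s1'"
      and 2: "exec D (Loop b c) s1' v' s''"
    have "v = t \<and> s1' = s1" by (rule LoopTrue.IH(1)[OF 1])
    moreover from this have "v' = t' \<and> s'' = s2" using LoopTrue.IH(2) 2 by blast
    ultimately show ?thesis using u by simp
  qed
qed (force elim: SkipE WriteE WriteRE)+

section \<open>Input and output\<close>

text \<open>The points are presented in an arbitrary order as a list \<open>ps\<close> and the machine only sees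
  their indices. Colors are encoded as \<open>1\<close> for \<open>H1\<close> and \<open>2\<close> for \<open>H2\<close>; all cells that hold no input are \<open>0\<close>.\<close>

definition dist_input :: "('a \<Rightarrow> 'a \<Rightarrow> real) \<Rightarrow> 'a list \<Rightarrow> nat \<Rightarrow> nat \<Rightarrow> real" where
  "dist_input d ps i j = (if i < length ps \<and> j < length ps then d (ps ! i) (ps ! j) else 0)"

definition init_state :: "'a list \<Rightarrow> 'a set \<Rightarrow> nat \<Rightarrow> nat \<Rightarrow> state" where
  "init_state ps H1 k z =
     ((\<lambda>v i. if v = ''n'' \<and> i = 0 then length ps
             else if v = ''k'' \<and> i = 0 then k
             else if v = ''z'' \<and> i = 0 then z
             else if v = ''color'' \<and> i < length ps then (if ps ! i \<in> H1 then 1 else 2)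
             else 0),
      (\<lambda>v i. 0))"

text \<open>Point \<open>i\<close> is a center iff \<open>center[i] \<noteq> 0\<close>. It is an outlier if \<open>assign[i] = 0\<close>, and
  it is assigned to point \<open>j\<close> if \<open>assign[i] = j + 1\<close>.\<close>

definition outputs :: "'a list \<Rightarrow> state \<Rightarrow> 'a set \<Rightarrow> ('a \<Rightarrow> 'a option) \<Rightarrow> bool" where
  "outputs ps s C \<alpha> \<longleftrightarrow>
     C = {ps ! j |j. j < length ps \<and> fst s ''center'' j \<noteq> 0} \<and>
     (\<forall>i < length ps.
        (fst s ''assign'' i = 0 \<and> \<alpha> (ps ! i) = None) \<or>
        (\<exists>j < length ps. fst s ''assign'' i = j + 1 \<and> \<alpha> (ps ! i) = Some (ps ! j)))"

end

theory Submission
  imports Defs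
begin

text \<open>For every pairwise distance \<open>r\<close>, a maximum matching between the colors with edges of length at most
  \<open>2 * r\<close> is computed by an auction, and then the blue endpoints of the matching edges are covered
  greedily by \<open>k\<close> balls of radius \<open>9 * r\<close>. If an optimal solution has cost \<open>r\<close>, its clusters induce complete
  bipartite graphs of edges of length at most \<open>2 * r\<close>, so a minimum vertex cover contains one color class
  of every cluster; hence the balls of radius \<open>3 * r\<close> around the optimal centers contain blue endpoints of
  at least as many matching edges as there are red points assigned by the optimum. The greedy argument
  for \<open>k\<close>-center with outliers loses a factor \<open>3\<close> in the radius, and sending each red partner to the same
  center adds \<open>2 * r\<close>, which gives \<open>9 * r + 2 * r = 11 * r\<close>. Each of the \<open>n\<^sup>2\<close> radii costs \<open>O(n\<^sup>3)\<close> steps.\<close>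

section \<open>Program logic with time bounds\<close>

text \<open>Both endpoints of a covered matching edge go to the same center, so every cluster is
  balanced by construction. What remains is a count: the outlier bound holds once twice the number
  of covered edges is at least \<open>n - z\<close>. The obstacle is that the matching is chosen
  without knowing an optimal clustering, so its edges may join different optimal clusters. A vertex
  cover can still be charged cluster by cluster; an edge caught only at its red endpoint has its
  blue endpoint up to \<open>2 * r\<close> further away, whence \<open>3 * r\<close> for the
  comparison balls. An auction is used because its final prices prove maximality by themselves, and
  because prices only rise and never exceed \<open>n + 1\<close>: O(n^2) bids, each with a linear
  scan, suffice. A radius may be accepted although no solution of that cost exists; what matters is
  that a rejected radius has none. On a nonempty instance the optimal cost is a pairwise distance,
  so the radius kept at the end is at most the optimal cost.\<close>

fun nvars :: "com \<Rightarrow> string set" where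
  "nvars Skip = {}"
| "nvars (Write v i e) = {v}"
| "nvars (WriteR v i e) = {}"
| "nvars (Seq c c') = nvars c \<union> nvars c'"
| "nvars (Cond b c c') = nvars c \<union> nvars c'"
| "nvars (Loop b c) = nvars c"

fun rvars :: "com \<Rightarrow> string set" where
  "rvars Skip = {}"
| "rvars (Write v i e) = {}"
| "rvars (WriteR v i e) = {v}"
| "rvars (Seq c c') = rvars c \<union> rvars c'"
| "rvars (Cond b c c') = rvars c \<union> rvars c'"
| "rvars (Loop b c) = rvars c"

text \<open>Whole named arrays are compared, so what a command leaves alone is read off its syntax.
  Loop invariants then need not mention the arrays that the body does not write.\<close>

definition frame :: "com \<Rightarrow> state \<Rightarrow> state \<Rightarrow> bool" where
  "frame c s s' \<longleftrightarrow>
     (\<forall>v. v \<notin> nvars c \<longrightarrow> fst s' v = fst s v) \<and> (\<forall>v. v \<notin> rvars c \<longrightarrow> snd s' v = snd s v)"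

lemma frame_refl: "frame c s s"
  by (simp add: frame_def)

lemma frame_trans: "frame c s s' \<Longrightarrow> frame c s' s'' \<Longrightarrow> frame c s s''"
  by (simp add: frame_def)

lemma exec_frame: "exec D c s t s' \<Longrightarrow> frame c s s'"
  by (induction rule: exec.induct) (auto simp: frame_def)

text \<open>Loop-free commands are executed symbolically by the simplifier; the proof rules below
  are then needed only for loops and for joining larger blocks.\<close>

fun straight :: "com \<Rightarrow> bool" where
  "straight (Seq c c') \<longleftrightarrow> straight c \<and> straight c'"
| "straight (Cond b c c') \<longleftrightarrow> straight c \<and> straight c'"
| "straight (Loop b c) \<longleftrightarrow> False"
| "straight c \<longleftrightarrow> True"

text \<open>The values of \<open>ctime\<close> and \<open>run\<close> on loops are dummies; both are only used for straight commands.\<close>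

fun ctime :: "com \<Rightarrow> nat" where
  "ctime Skip = 1"
| "ctime (Write v i e) = 1 + ntime i + ntime e"
| "ctime (WriteR v i e) = 1 + ntime i + rtime e"
| "ctime (Seq c c') = ctime c + ctime c'"
| "ctime (Cond b c c') = 1 + ttime b + max (ctime c) (ctime c')"
| "ctime (Loop b c) = 0"

fun run :: "(nat \<Rightarrow> nat \<Rightarrow> real) \<Rightarrow> com \<Rightarrow> state \<Rightarrow> state" where
  "run D Skip s = s"
| "run D (Write v i e) s = ((fst s)(v := (fst s v)(nval i s := nval e s)), snd s)"
| "run D (WriteR v i e) s = (fst s, (snd s)(v := (snd s v)(nval i s := rval D e s)))"
| "run D (Seq c c') s = run D c' (run D c s)"
| "run D (Cond b c c') s = (if tval D b s then run D c s else run D c' s)"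
| "run D (Loop b c) s = s"

lemma exec_run: "straight c \<Longrightarrow> \<exists>t \<le> ctime c. exec D c s t (run D c s)"
proof (induction c arbitrary: s)
  case (Seq c c')
  obtain t where "t \<le> ctime c" "exec D c s t (run D c s)"
    using Seq.IH(1)[of s] Seq.prems by auto
  moreover obtain t' where "t' \<le> ctime c'" "exec D c' (run D c s) t' (run D c' (run D c s))"
    using Seq.IH(2)[of "run D c s"] Seq.prems by auto
  ultimately show ?case by (auto intro!: exI[of _ "t + t'"] exec.Seq)
next
  case (Cond b c c')
  show ?case
  proof (cases "tval D b s")
    case True
    obtain t where "t \<le> ctime c" "exec D c s t (run D c s)"
      using Cond.IH(1)[of s] Cond.prems by auto
    then have "1 + ttime b + t \<le> ctime (Cond b c c')" "exec D (Cond b c c') s (1 + ttime b + t) (run D c s)"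
      using True by (auto intro: exec.CondTrue[simplified])
    then show ?thesis using True by (auto simp del: ctime.simps)
  next
    case False
    obtain t where "t \<le> ctime c'" "exec D c' s t (run D c' s)"
      using Cond.IH(2)[of s] Cond.prems by auto
    then have "1 + ttime b + t \<le> ctime (Cond b c c')" "exec D (Cond b c c') s (1 + ttime b + t) (run D c' s)"
      using False by (auto intro: exec.CondFalse[simplified])
    then show ?thesis using False by (auto simp del: ctime.simps)
  qed
next
  case Skip
  show ?case using exec.Skip[of D s] by auto
next
  case (Write v i e)
  show ?case using exec.Write[of D v i e s] by (intro exI[of _ "ctime (Write v i e)"]) simp
next
  case (WriteR v i e)
  show ?case using exec.WriteR[of D v i e s] by (intro exI[of _ "ctime (WriteR v i e)"]) simp
qed auto

text \<open>Total correctness with a step budget: halting is part of the claim. Since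
  \<open>exec\<close> is deterministic, the existential speaks about the only run.\<close>

definition wp :: "(nat \<Rightarrow> nat \<Rightarrow> real) \<Rightarrow> com \<Rightarrow> nat \<Rightarrow> (state \<Rightarrow> bool) \<Rightarrow> state \<Rightarrow> bool" where
  "wp D c b Q s \<longleftrightarrow> (\<exists>t s'. exec D c s t s' \<and> t \<le> b \<and> Q s')"

lemma wp_conseq:
  assumes "wp D c b Q s" "\<And>s'. Q s' \<Longrightarrow> frame c s s' \<Longrightarrow> Q' s'" "b \<le> b'"
  shows "wp D c b' Q' s"
  using assms exec_frame unfolding wp_def by (meson order.trans)

lemma wp_run: "straight c \<Longrightarrow> ctime c \<le> b \<Longrightarrow> Q (run D c s) \<Longrightarrow> wp D c b Q s"
  using exec_run[of c D s] unfolding wp_def by (meson order.trans)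

lemma wp_Seq:
  assumes "wp D c b Q s" "\<And>s'. Q s' \<Longrightarrow> frame c s s' \<Longrightarrow> wp D c' b' Q' s'" "b + b' \<le> b''"
  shows "wp D (Seq c c') b'' Q' s"
proof -
  obtain t s' where 1: "exec D c s t s'" "t \<le> b" "Q s'" using assms(1) by (auto simp: wp_def)
  then obtain t' s'' where "exec D c' s' t' s''" "t' \<le> b'" "Q' s''"
    using assms(2)[OF 1(3) exec_frame[OF 1(1)]] unfolding wp_def by blast
  then show ?thesis using 1 assms(3) exec.Seq[of D c s t s' c' t' s'']
    unfolding wp_def by (meson add_mono order.trans)
qed

lemma wp_Cond:
  assumes "tval D b s \<Longrightarrow> wp D c t Q s" "\<not> tval D b s \<Longrightarrow> wp D c' t Q s" "1 + ttime b + t \<le> t'"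
  shows "wp D (Cond b c c') t' Q s"
proof (cases "tval D b s")
  case True
  then obtain u s' where "exec D c s u s'" "u \<le> t" "Q s'" using assms(1) by (auto simp: wp_def)
  then show ?thesis using True assms(3) exec.CondTrue[of D b s c u s' c'] unfolding wp_def
    by (meson add_left_mono order.trans)
next
  case False
  then obtain u s' where "exec D c' s u s'" "u \<le> t" "Q s'" using assms(2) by (auto simp: wp_def)
  then show ?thesis using False assms(3) exec.CondFalse[of D b s c' u s' c] unfolding wp_def
    by (meson add_left_mono order.trans)
qed

text \<open>Each unit of the potential \<open>m\<close> pays for one test and one body, so there are
  at most \<open>M\<close> rounds; the extra \<open>1\<close> in \<open>M + 1\<close> pays for the
  final failing test. The frame relates every intermediate state to the state before the loop, so
  facts about unwritten arrays stay available.\<close>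

lemma wp_Loop:
  fixes m :: "state \<Rightarrow> nat"
  assumes init: "I s"
    and step: "\<And>s'. I s' \<Longrightarrow> frame c s s' \<Longrightarrow> tval D b s' \<Longrightarrow> wp D c t (\<lambda>s''. I s'' \<and> m s'' < m s') s'"
    and exit: "\<And>s'. I s' \<Longrightarrow> frame c s s' \<Longrightarrow> \<not> tval D b s' \<Longrightarrow> Q s'"
    and time: "m s \<le> M" "(M + 1) * (1 + ttime b + t) \<le> t'"
  shows "wp D (Loop b c) t' Q s"
proof -
  have "wp D (Loop b c) (m s' * (1 + ttime b + t) + 1 + ttime b) Q s'" if "I s'" "frame c s s'" for s'
    using that
  proof (induction "m s'" arbitrary: s' rule: less_induct)
    case less
    show ?case
    proof (cases "tval D b s'")
      case False
      then show ?thesis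
        using exec.LoopFalse[of D b s' c] exit[OF less.prems] unfolding wp_def
        by (metis add.assoc le_add2)
    next
      case True
      obtain u s1 where 1: "exec D c s' u s1" "u \<le> t" "I s1" "m s1 < m s'"
        using step[OF less.prems True] by (auto simp: wp_def)
      have "frame c s s1" using exec_frame[OF 1(1)] less.prems frame_trans by blast
      then obtain u' s2 where 2: "exec D (Loop b c) s1 u' s2"
          "u' \<le> m s1 * (1 + ttime b + t) + 1 + ttime b" "Q s2"
        using less.hyps[OF 1(4,3)] by (auto simp: wp_def)
      have "Suc (m s1) * (1 + ttime b + t) \<le> m s' * (1 + ttime b + t)"
        using 1(4) by (intro mult_right_mono) auto
      then have "1 + ttime b + u + u' \<le> m s' * (1 + ttime b + t) + 1 + ttime b"
        using 1(2) 2(2) by (simp add: algebra_simps)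
      then show ?thesis using exec.LoopTrue[OF True 1(1) 2(1)] 2(3) unfolding wp_def by blast
    qed
  qed
  from this[OF init frame_refl] have "wp D (Loop b c) (m s * (1 + ttime b + t) + 1 + ttime b) Q s" .
  moreover have "m s * (1 + ttime b + t) \<le> M * (1 + ttime b + t)"
    using time(1) by (rule mult_right_mono) simp
  then have "m s * (1 + ttime b + t) + 1 + ttime b \<le> t'"
    using time(2) by (simp add: algebra_simps)
  ultimately show ?thesis by (auto intro: wp_conseq)
qed

abbreviation Var :: "string \<Rightarrow> nexp" where "Var v \<equiv> Read v (Const 0)"
abbreviation Assign :: "string \<Rightarrow> nexp \<Rightarrow> com" where "Assign v e \<equiv> Write v (Const 0) e"

definition For :: "string \<Rightarrow> com \<Rightarrow> com" where
  "For v c = Seq (Assign v (Const 0))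
     (Loop (Less (Var v) (Var ''n'')) (Seq c (Assign v (Plus (Var v) (Const 1)))))"

lemma vars_For [simp]: "nvars (For v c) = insert v (nvars c)" "rvars (For v c) = rvars c"
  by (auto simp: For_def)

text \<open>The body establishes \<open>I (Suc j)\<close> before the counter is incremented, so
  \<open>stable\<close> demands that the invariant ignore the counter cell. The \<open>12\<close>
  pays for the loop command, its test (\<open>6\<close> together) and the increment
  (\<open>6\<close>); the \<open>3\<close> pays for setting the counter to zero.\<close>

lemma wp_For:
  assumes v: "v \<noteq> ''n''" "v \<notin> nvars c" "''n'' \<notin> nvars c" and n: "fst s ''n'' 0 = n"
    and init: "I 0 s"
    and step: "\<And>j s'. j < n \<Longrightarrow> I j s' \<Longrightarrow> frame (For v c) s s' \<Longrightarrow> fst s' v 0 = j \<Longrightarrow> wp D c t (I (Suc j)) s'"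
    and stable: "\<And>j s' x. I j s' \<Longrightarrow> I j ((fst s')(v := (fst s' v)(0 := x)), snd s')"
    and exit: "\<And>s'. I n s' \<Longrightarrow> frame (For v c) s s' \<Longrightarrow> Q s'"
    and time: "(n + 1) * (t + 12) + 3 \<le> t'"
  shows "wp D (For v c) t' Q s"
proof -
  let ?b = "Less (Var v) (Var ''n'')" and ?c = "Seq c (Assign v (Plus (Var v) (Const 1)))"
  let ?s = "((fst s)(v := (fst s v)(0 := 0)), snd s)"
  let ?J = "\<lambda>s'. fst s' v 0 \<le> n \<and> I (fst s' v 0) s'"
  have fr: "frame (For v c) s s'" if "frame ?c ?s s'" for s'
    using that by (auto simp: frame_def)
  have "wp D (Loop ?b ?c) ((n + 1) * (t + 12)) Q ?s"
  proof (rule wp_Loop[where I = ?J and m = "\<lambda>s'. n - fst s' v 0" and t = "t + 6" and M = n])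
    show "?J ?s" using stable[OF init] by simp
  next
    fix s' assume J: "?J s'" and f: "frame ?c ?s s'" and b: "tval D ?b s'"
    let ?j = "fst s' v 0"
    have n': "fst s' ''n'' 0 = n" using f v n by (auto simp: frame_def)
    then have lt: "?j < n" using b by simp
    show "wp D ?c (t + 6) (\<lambda>s''. ?J s'' \<and> n - fst s'' v 0 < n - fst s' v 0) s'"
    proof (rule wp_Seq[where b = t and b' = 6])
      show "wp D c t (I (Suc ?j)) s'" using step[OF lt _ fr[OF f]] J by simp
    next
      fix s1 assume I1: "I (Suc ?j) s1" and f1: "frame c s' s1"
      then have "fst s1 v 0 = ?j" using v by (simp add: frame_def)
      then show "wp D (Assign v (Plus (Var v) (Const 1))) 6
          (\<lambda>s''. ?J s'' \<and> n - fst s'' v 0 < n - fst s' v 0) s1"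
        using lt stable[OF I1] by (intro wp_run) auto
    qed simp
  next
    fix s' assume J: "?J s'" and f: "frame ?c ?s s'" and b: "\<not> tval D ?b s'"
    have "fst s' ''n'' 0 = n" using f v n by (auto simp: frame_def)
    then have "fst s' v 0 = n" using b J by simp
    then show "Q s'" using exit[OF _ fr[OF f]] J by simp
  qed auto
  then show ?thesis
    unfolding For_def using time
    by (intro wp_Seq[where b = 3 and Q = "\<lambda>s'. s' = ?s"]) (auto intro: wp_run)
qed

section \<open>Matching and greedy covering\<close>

text \<open>The machine sees indices only. The axioms are confined to indices below \<open>n\<close>
  because the input matrix is \<open>0\<close> elsewhere, which would break the triangle
  inequality.\<close>

locale center_instance =
  fixes n k z :: nat and color :: "nat \<Rightarrow> nat" and D :: "nat \<Rightarrow> nat \<Rightarrow> real"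
  assumes color: "i < n \<Longrightarrow> color i = 1 \<or> color i = 2"
    and D_sym: "i < n \<Longrightarrow> j < n \<Longrightarrow> D i j = D j i"
    and D_triangle: "i < n \<Longrightarrow> j < n \<Longrightarrow> l < n \<Longrightarrow> D i l \<le> D i j + D j l"
    and D_self: "i < n \<Longrightarrow> D i i = 0"
begin

lemma D_nonneg: "i < n \<Longrightarrow> j < n \<Longrightarrow> 0 \<le> D i j"
  using D_triangle[of i j i] D_sym[of i j] D_self[of i] by simp

definition red :: "nat set" where "red = {i. i < n \<and> color i = 1}"
definition blue :: "nat set" where "blue = {i. i < n \<and> color i = 2}"

lemma red_less: "u \<in> red \<Longrightarrow> u < n" and blue_less: "v \<in> blue \<Longrightarrow> v < n"
  by (auto simp: red_def blue_def)

lemma finite_colors [simp]: "finite red" "finite blue"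
  by (auto simp: red_def blue_def)

text \<open>A fair clustering of cost at most \<rho>, stated directly in the output format of the
  machine. Outliers are counted through their complement to avoid truncated subtraction. Balance is
  asked at every index, not only at centers; this is harmless because the second clause leaves the
  other clusters empty.\<close>

definition solution :: "real \<Rightarrow> (nat \<Rightarrow> nat) \<Rightarrow> (nat \<Rightarrow> nat) \<Rightarrow> bool" where
  "solution \<rho> center assign \<longleftrightarrow>
     card {j. j < n \<and> center j \<noteq> 0} \<le> k \<and>
     (\<forall>i<n. assign i \<noteq> 0 \<longrightarrow>
        assign i \<le> n \<and> center (assign i - 1) \<noteq> 0 \<and> D i (assign i - 1) \<le> \<rho>) \<and>
     n \<le> z + card {i. i < n \<and> assign i \<noteq> 0} \<and>
     (\<forall>j<n. card {i \<in> red. assign i = Suc j} = card {i \<in> blue. assign i = Suc j})"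

section \<open>Maximum matching by an auction\<close>

definition matched :: "(nat \<Rightarrow> nat) \<Rightarrow> nat set" where
  "matched mate = {v. v < n \<and> mate v \<noteq> 0}"

lemma finite_matched [simp]: "finite (matched mate)"
  by (simp add: matched_def)

text \<open>\<open>mate v = u + 1\<close> says that the red point \<open>u\<close> holds the blue point \<open>v\<close>, and \<open>cur = u + 1\<close> that \<open>u\<close> is
  bidding; \<open>0\<close> means none. The red points below \<open>next\<close> have entered the auction, and they give up
  once all their neighbors cost more than \<open>n\<close>.\<close>

definition auction ::
  "real \<Rightarrow> (nat \<Rightarrow> nat) \<Rightarrow> (nat \<Rightarrow> nat) \<Rightarrow> nat \<Rightarrow> nat \<Rightarrow> bool" where
  "auction r mate price cur next \<longleftrightarrow>
     (\<forall>v \<in> matched mate. v \<in> blue \<and> mate v \<noteq> cur \<and>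
        (\<exists>u. mate v = Suc u \<and> u \<in> red \<and> u < next \<and> D u v \<le> 2 * r \<and>
           (\<forall>v' \<in> blue. D u v' \<le> 2 * r \<longrightarrow> price v \<le> price v' + 1))) \<and>
     inj_on mate (matched mate) \<and>
     (\<forall>v<n. price v \<noteq> 0 \<longrightarrow> mate v \<noteq> 0) \<and>
     (\<forall>v<n. price v \<le> n + 1) \<and>
     (cur \<noteq> 0 \<longrightarrow> cur \<le> next \<and> cur - 1 \<in> red) \<and> next \<le> n \<and>
     (\<forall>u \<in> red. u < next \<longrightarrow> Suc u = cur \<or> Suc u \<in> mate ` matched mate \<or>
        (\<forall>v \<in> blue. D u v \<le> 2 * r \<longrightarrow> n < price v))"

lemma auction_init:
  assumes "\<And>v. v < n \<Longrightarrow> mate v = 0" "\<And>v. v < n \<Longrightarrow> price v = 0"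
  shows "auction r mate price 0 0"
proof -
  have "matched mate = {}" using assms by (auto simp: matched_def)
  then show ?thesis using assms by (auto simp: auction_def)
qed

lemma auction_next:
  assumes a: "auction r mate price 0 u" and u: "u < n"
  shows "auction r mate price (if color u = 1 then Suc u else 0) (Suc u)"
proof (cases "color u = 1")
  case True
  then have "u \<in> red" using u by (simp add: red_def)
  have edge: "v \<in> blue \<and> (\<exists>u'. mate v = Suc u' \<and> u' \<in> red \<and> u' < u \<and> D u' v \<le> 2 * r \<and>
      (\<forall>v' \<in> blue. D u' v' \<le> 2 * r \<longrightarrow> price v \<le> price v' + 1))" if "v \<in> matched mate" for v
    using a that unfolding auction_def by blast
  have 1: "\<forall>v \<in> matched mate. v \<in> blue \<and> mate v \<noteq> Suc u \<and>
      (\<exists>u'. mate v = Suc u' \<and> u' \<in> red \<and> u' < Suc u \<and> D u' v \<le> 2 * r \<and>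
      (\<forall>v' \<in> blue. D u' v' \<le> 2 * r \<longrightarrow> price v \<le> price v' + 1))"
  proof
    fix v assume "v \<in> matched mate"
    from edge[OF this] obtain u' where "v \<in> blue" "mate v = Suc u'" "u' \<in> red" "u' < u" "D u' v \<le> 2 * r"
      "\<forall>v' \<in> blue. D u' v' \<le> 2 * r \<longrightarrow> price v \<le> price v' + 1" by blast
    then show "v \<in> blue \<and> mate v \<noteq> Suc u \<and>
      (\<exists>u'. mate v = Suc u' \<and> u' \<in> red \<and> u' < Suc u \<and> D u' v \<le> 2 * r \<and>
      (\<forall>v' \<in> blue. D u' v' \<le> 2 * r \<longrightarrow> price v \<le> price v' + 1))" by simp
  qed
  have 2: "Suc x = Suc u \<or> Suc x \<in> mate ` matched mate \<or>
      (\<forall>v \<in> blue. D x v \<le> 2 * r \<longrightarrow> n < price v)" if "x \<in> red" "x < Suc u" for x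
    using a that unfolding auction_def by (metis Zero_not_Suc less_SucE)
  have "inj_on mate (matched mate)" "\<forall>v<n. price v \<noteq> 0 \<longrightarrow> mate v \<noteq> 0" "\<forall>v<n. price v \<le> n + 1"
    using a unfolding auction_def by blast+
  then have "auction r mate price (Suc u) (Suc u)"
    unfolding auction_def using 1 2 u \<open>u \<in> red\<close> by (intro conjI) auto
  then show ?thesis using True by simp
next
  case False
  then have "x < u" if "x \<in> red" "x < Suc u" for x using that by (auto simp: red_def less_Suc_eq)
  then have "Suc x \<in> mate ` matched mate \<or> (\<forall>v \<in> blue. D x v \<le> 2 * r \<longrightarrow> n < price v)"
    if "x \<in> red" "x < Suc u" for x
    using a that unfolding auction_def by (metis Zero_not_Suc)
  moreover have "v \<in> blue \<and> mate v \<noteq> 0 \<and> (\<exists>u'. mate v = Suc u' \<and> u' \<in> red \<and> u' < Suc u \<and> D u' v \<le> 2 * r \<and>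
      (\<forall>v' \<in> blue. D u' v' \<le> 2 * r \<longrightarrow> price v \<le> price v' + 1))" if "v \<in> matched mate" for v
    using a that unfolding auction_def by (metis less_SucI)
  moreover have "inj_on mate (matched mate)" "\<forall>v<n. price v \<noteq> 0 \<longrightarrow> mate v \<noteq> 0"
    "\<forall>v<n. price v \<le> n + 1"
    using a unfolding auction_def by blast+
  ultimately have "auction r mate price 0 (Suc u)"
    unfolding auction_def using u by (intro conjI) auto
  then show ?thesis using False by simp
qed

lemma auction_give_up:
  assumes a: "auction r mate price (Suc u) next"
    and "\<And>v. v \<in> blue \<Longrightarrow> D u v \<le> 2 * r \<Longrightarrow> n < price v"
  shows "auction r mate price 0 next"
proof -
  have "v \<in> blue \<and> mate v \<noteq> 0 \<and> (\<exists>u. mate v = Suc u \<and> u \<in> red \<and> u < next \<and> D u v \<le> 2 * r \<and>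
      (\<forall>v' \<in> blue. D u v' \<le> 2 * r \<longrightarrow> price v \<le> price v' + 1))" if "v \<in> matched mate" for v
    using a that unfolding auction_def by (simp add: matched_def)
  moreover have "Suc x \<in> mate ` matched mate \<or> (\<forall>v \<in> blue. D x v \<le> 2 * r \<longrightarrow> n < price v)"
    if "x \<in> red" "x < next" for x
    using assms that unfolding auction_def by (metis Suc_inject)
  moreover have "inj_on mate (matched mate)" "\<forall>v<n. price v \<noteq> 0 \<longrightarrow> mate v \<noteq> 0"
    "\<forall>v<n. price v \<le> n + 1" "next \<le> n"
    using a unfolding auction_def by blast+
  ultimately show ?thesis unfolding auction_def by (intro conjI) auto
qed

text \<open>The invariant is complementary slackness up to \<open>1\<close>: a holder's point costs
  at most \<open>1\<close> more than its cheapest neighbor. Raising a cheapest price by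
  \<open>1\<close> preserves this for the bidder, and raising prices of other points only helps the
  other holders. The evicted holder becomes the bidder, and \<open>cur\<close> becomes
  \<open>0\<close> if the point was free. Bidding only on prices at most \<open>n\<close> keeps all
  prices at most \<open>n + 1\<close>.\<close>

lemma auction_bid:
  assumes a: "auction r mate price (Suc u) next"
    and v: "v \<in> blue" "D u v \<le> 2 * r" "price v \<le> n"
    and cheapest: "\<And>v'. v' \<in> blue \<Longrightarrow> D u v' \<le> 2 * r \<Longrightarrow> price v \<le> price v'"
  shows "auction r (mate(v := Suc u)) (price(v := Suc (price v))) (mate v) next"
proof -
  let ?m = "mate(v := Suc u)" and ?p = "price(v := Suc (price v))"
  have vn: "v < n" using v by (simp add: blue_less)
  have M: "matched ?m = insert v (matched mate)" using vn by (auto simp: matched_def)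
  have u: "u \<in> red" "u < next" "next \<le> n" using a by (auto simp: auction_def)
  have inj: "inj_on mate (matched mate)" and
    A: "\<And>w. w \<in> matched mate \<Longrightarrow> w \<in> blue \<and> mate w \<noteq> Suc u \<and>
        (\<exists>u. mate w = Suc u \<and> u \<in> red \<and> u < next \<and> D u w \<le> 2 * r \<and>
           (\<forall>v' \<in> blue. D u v' \<le> 2 * r \<longrightarrow> price w \<le> price v' + 1))"
    using a unfolding auction_def by blast+
  \<comment> \<open>The evicted red point held only \<open>v\<close>, so it is unmatched afterwards
    and may serve as the new \<open>cur\<close>.\<close>
  have other: "mate w \<noteq> mate v" if "w \<in> matched mate" "w \<noteq> v" for w
    using inj_onD[OF inj, of w v] that vn by (auto simp: matched_def)
  have new: "Suc u \<noteq> mate v"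
  proof (cases "mate v = 0")
    case False
    then have "v \<in> matched mate" using vn by (simp add: matched_def)
    from A[OF this] show ?thesis by metis
  qed simp
  have 1: "\<forall>w \<in> matched ?m. w \<in> blue \<and> ?m w \<noteq> mate v \<and>
        (\<exists>u. ?m w = Suc u \<and> u \<in> red \<and> u < next \<and> D u w \<le> 2 * r \<and>
           (\<forall>v' \<in> blue. D u v' \<le> 2 * r \<longrightarrow> ?p w \<le> ?p v' + 1))"
  proof
    fix w assume w: "w \<in> matched ?m"
    show "w \<in> blue \<and> ?m w \<noteq> mate v \<and>
        (\<exists>u. ?m w = Suc u \<and> u \<in> red \<and> u < next \<and> D u w \<le> 2 * r \<and>
           (\<forall>v' \<in> blue. D u v' \<le> 2 * r \<longrightarrow> ?p w \<le> ?p v' + 1))"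
    proof (cases "w = v")
      case True
      have "Suc (price v) \<le> ?p v' + 1" if "v' \<in> blue" "D u v' \<le> 2 * r" for v'
        using cheapest[OF that] by simp
      then show ?thesis using True v u new by simp
    next
      case False
      then have w: "w \<in> matched mate" using w M by auto
      then obtain u' where u': "mate w = Suc u'" "u' \<in> red" "u' < next" "D u' w \<le> 2 * r"
         "\<And>v'. v' \<in> blue \<Longrightarrow> D u' v' \<le> 2 * r \<Longrightarrow> price w \<le> price v' + 1" using A by blast
      have "?m w \<noteq> mate v" "w \<in> blue" using other[OF w False] False A[OF w] by simp_all
      moreover have "?p w \<le> ?p v' + 1" if "v' \<in> blue" "D u' v' \<le> 2 * r" for v'
        using u'(5)[OF that] False by auto
      moreover have "?m w = Suc u'" using u'(1) False by simp
      ultimately show ?thesis using u'(2-4) by blast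
    qed
  qed
  have 2: "inj_on ?m (matched ?m)"
  proof -
    \<comment> \<open>If \<open>v\<close> was free, its value \<open>0\<close> differs from all
      matched values, so \<open>mate\<close> stays injective when \<open>v\<close> joins its domain;
      the update to the fresh value \<open>Suc u\<close> then keeps injectivity.\<close>
    have "inj_on mate (insert v (matched mate))"
    proof -
      have "mate v \<notin> mate ` (matched mate - {v})"
      proof
        assume "mate v \<in> mate ` (matched mate - {v})"
        then obtain w where "mate v = mate w" "w \<in> matched mate" "w \<noteq> v" by blast
        then show False using other[of w] by simp
      qed
      then show ?thesis using inj unfolding inj_on_insert by simp
    qed
    moreover have "Suc u \<notin> mate ` insert v (matched mate)"
    proof
      assume "Suc u \<in> mate ` insert v (matched mate)"
      then obtain w where "Suc u = mate w" "w \<in> matched mate" using new by blast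
      then show False using A[of w] by metis
    qed
    ultimately show ?thesis unfolding M by (rule inj_on_fun_updI)
  qed
  have 3: "mate v \<noteq> 0 \<longrightarrow> mate v \<le> next \<and> mate v - 1 \<in> red"
  proof
    assume "mate v \<noteq> 0"
    then obtain u' where "mate v = Suc u'" "u' \<in> red" "u' < next"
      using A[of v] vn by (auto simp: matched_def)
    then show "mate v \<le> next \<and> mate v - 1 \<in> red" by simp
  qed
  have 4: "\<forall>x \<in> red. x < next \<longrightarrow> Suc x = mate v \<or> Suc x \<in> ?m ` matched ?m \<or>
        (\<forall>w \<in> blue. D x w \<le> 2 * r \<longrightarrow> n < ?p w)"
  proof (intro ballI impI)
    fix x assume "x \<in> red" "x < next"
    then consider "x = u" | w where "w \<in> matched mate" "mate w = Suc x"
      | "\<forall>w \<in> blue. D x w \<le> 2 * r \<longrightarrow> n < price w"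
      using a unfolding auction_def by (metis (no_types, lifting) Suc_inject imageE)
    then show "Suc x = mate v \<or> Suc x \<in> ?m ` matched ?m \<or>
        (\<forall>w \<in> blue. D x w \<le> 2 * r \<longrightarrow> n < ?p w)"
    proof cases
      case 2
      show ?thesis
      proof (cases "w = v")
        case False
        then have "?m w = Suc x" "w \<in> matched ?m" using 2 M by auto
        then have "Suc x \<in> ?m ` matched ?m" by (metis imageI)
        then show ?thesis by blast
      qed (use 2 in auto)
    next
      case 1
      then have "?m v = Suc x" "v \<in> matched ?m" using M by auto
      then have "Suc x \<in> ?m ` matched ?m" by (metis imageI)
      then show ?thesis by blast
    next
      case 3
      have "n < ?p w" if "n < price w" for w using that by auto
      then show ?thesis using 3 by blast
    qed
  qed
  have 5: "\<forall>w<n. ?p w \<noteq> 0 \<longrightarrow> ?m w \<noteq> 0" "\<forall>w<n. ?p w \<le> n + 1"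
  proof -
    have "price w \<noteq> 0 \<longrightarrow> mate w \<noteq> 0" "price w \<le> n + 1" if "w < n" for w
      using a that unfolding auction_def by blast+
    then show "\<forall>w<n. ?p w \<noteq> 0 \<longrightarrow> ?m w \<noteq> 0" "\<forall>w<n. ?p w \<le> n + 1" using v(3) by auto
  qed
  show ?thesis unfolding auction_def using 1 2 3 4 5 u(3) by (intro conjI) assumption+
qed

text \<open>Maximality is expressed by a vertex cover as in Koenig's theorem: each matching edge
  contributes its blue endpoint if that lies in \<open>T\<close>, and its red endpoint otherwise.\<close>

definition maximum_matching :: "real \<Rightarrow> (nat \<Rightarrow> nat) \<Rightarrow> bool" where
  "maximum_matching r mate \<longleftrightarrow>
     (\<forall>v \<in> matched mate. v \<in> blue \<and> (\<exists>u. mate v = Suc u \<and> u \<in> red \<and> D u v \<le> 2 * r)) \<and>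
     inj_on mate (matched mate) \<and>
     (\<exists>T. \<forall>u \<in> red. \<forall>v \<in> blue. D u v \<le> 2 * r \<longrightarrow>
        v \<in> matched mate \<inter> T \<or> Suc u \<in> mate ` (matched mate - T))"

text \<open>Some price level \<open>t\<close> between \<open>1\<close> and \<open>n + 1\<close> is not attained, and the blue points above such
  a gap yield the cover.\<close>

lemma auction_maximum_matching:
  assumes a: "auction r mate price 0 n"
  shows "maximum_matching r mate"
proof -
  \<comment> \<open>The \<open>n\<close> blue and red indices have at most \<open>n\<close>
    different prices, too few for the \<open>n + 1\<close> levels.\<close>
  have "card (price ` {..<n}) < card {1..n + 1}"
    using card_image_le[of "{..<n}" price] by simp
  then obtain t where t: "t \<in> {1..n + 1}" "t \<notin> price ` {..<n}"
    by (metis card_mono finite_imageI finite_lessThan leD subsetI)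
  let ?T = "{v. t < price v}"
  have "v \<in> matched mate \<inter> ?T \<or> Suc u \<in> mate ` (matched mate - ?T)"
    if u: "u \<in> red" and v: "v \<in> blue" and uv: "D u v \<le> 2 * r" for u v
  proof (cases "t < price v")
    case True
    then show ?thesis using a v unfolding auction_def by (auto simp: matched_def dest: blue_less)
  next
    case False
    \<comment> \<open>The level \<open>t\<close> is not attained, so the price of \<open>v\<close>
      is strictly below it and hence at most \<open>n\<close>. Thus \<open>u\<close> has not given
      up and holds some \<open>w\<close>, whose price is at most one more than that of
      \<open>v\<close>, hence at most \<open>t\<close>. So \<open>w\<close> is outside
      \<open>?T\<close>; without the gap this could fail by one.\<close>
    then have lt: "price v < t" using t(2) v by (metis blue_less image_eqI lessThan_iff nat_neq_iff)
    then have "\<not> (\<forall>w \<in> blue. D u w \<le> 2 * r \<longrightarrow> n < price w)" using t v uv by fastforce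
    then have "Suc u \<in> mate ` matched mate"
      using a u unfolding auction_def by (metis Zero_not_Suc red_less)
    then obtain w where w: "w \<in> matched mate" "Suc u = mate w" by blast
    then obtain u' where "mate w = Suc u'" "\<forall>v' \<in> blue. D u' v' \<le> 2 * r \<longrightarrow> price w \<le> price v' + 1"
      using a unfolding auction_def by blast
    then have "price w \<le> price v + 1" using w v uv by simp
    then have "w \<notin> ?T" using lt by simp
    then show ?thesis using w by blast
  qed
  then show ?thesis using a unfolding auction_def maximum_matching_def by blast
qed

section \<open>Covering matching edges by balls\<close>

definition near :: "real \<Rightarrow> nat set \<Rightarrow> nat set" where
  "near \<rho> S = {v. v < n \<and> (\<exists>s \<in> S. D s v \<le> \<rho>)}"

text \<open>Within a cluster of a solution every red-blue pair is at distance at most \<open>2 * r\<close>, so the cover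
  contains all its red or all its blue points.\<close>

lemma solution_near_matched:
  assumes mm: "maximum_matching r mate" and sol: "solution r center assign"
  shows "\<exists>S \<subseteq> {..<n}. card S \<le> k \<and> n \<le> z + 2 * card (matched mate \<inter> near (3 * r) S)"
proof -
  define S where "S = {j. j < n \<and> center j \<noteq> 0}"
  define R where "R j = {i \<in> red. assign i = Suc j}" for j
  define B where "B j = {i \<in> blue. assign i = Suc j}" for j
  obtain T where T: "\<And>u v. u \<in> red \<Longrightarrow> v \<in> blue \<Longrightarrow> D u v \<le> 2 * r \<Longrightarrow>
      v \<in> matched mate \<inter> T \<or> Suc u \<in> mate ` (matched mate - T)"
    using mm unfolding maximum_matching_def by blast
  have edge: "\<And>v. v \<in> matched mate \<Longrightarrow> v \<in> blue \<and> (\<exists>u. mate v = Suc u \<and> u \<in> red \<and> D u v \<le> 2 * r)"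
    and inj: "inj_on mate (matched mate)"
    using mm unfolding maximum_matching_def by blast+
  have dist: "D i j \<le> r" if "i \<in> R j \<union> B j" for i j
    using sol that unfolding solution_def R_def B_def by (auto dest!: red_less blue_less)
  have eq: "card (R j) = card (B j)" if "j \<in> S" for j
    using sol that unfolding solution_def R_def B_def S_def by auto
  \<comment> \<open>\<open>F j\<close> collects, by their blue endpoints, the matching edges whose
    cover vertex is charged to cluster \<open>j\<close>: the blue points of the cluster if all of
    them are in the cover, otherwise the partners of its red points.\<close>
  define F where "F j = (if B j \<subseteq> matched mate \<inter> T then B j
    else {w \<in> matched mate - T. mate w \<in> Suc ` R j})" for j
  have F_card: "card (R j) \<le> card (F j)" if j: "j \<in> S" for j
  proof (cases "B j \<subseteq> matched mate \<inter> T")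
    case True
    then show ?thesis using eq[OF j] by (simp add: F_def)
  next
    case False
    \<comment> \<open>One blue point of the cluster outside the cover forces every red point of the
      cluster into it, since all these pairs are edges.\<close>
    then obtain v where v: "v \<in> B j" "v \<notin> matched mate \<inter> T" by blast
    have covered: "Suc u \<in> mate ` (matched mate - T)" if u: "u \<in> R j" for u
    proof -
      have "u < n" "v < n" "j < n" using u v j by (auto simp: R_def B_def S_def red_less blue_less)
      then have "D u v \<le> 2 * r"
        using D_triangle[of u j v] D_sym[of j v] dist[of u j] dist[of v j] u v by simp
      then show ?thesis using T[of u v] u v by (auto simp: R_def B_def)
    qed
    have F: "F j = {w \<in> matched mate - T. mate w \<in> Suc ` R j}" unfolding F_def using False by (rule if_not_P)
    have "Suc ` R j \<subseteq> mate ` F j"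
    proof
      fix x assume x: "x \<in> Suc ` R j"
      then obtain w where "x = mate w" "w \<in> matched mate - T" using covered by blast
      then show "x \<in> mate ` F j" using x unfolding F by blast
    qed
    then have "card (Suc ` R j) \<le> card (F j)"
      by (rule surj_card_le[rotated]) (simp add: F)
    then show ?thesis by (simp add: card_image)
  qed
  have F_sub: "F j \<subseteq> matched mate \<inter> near (3 * r) S" if j: "j \<in> S" for j
  proof
    fix w assume w: "w \<in> F j"
    have jn: "j < n" using j by (simp add: S_def)
    have "w \<in> matched mate \<and> D j w \<le> 3 * r"
    proof (cases "B j \<subseteq> matched mate \<inter> T")
      case True
      then have "w \<in> B j" "w \<in> matched mate" using w by (auto simp: F_def)
      moreover from this have "D j w \<le> r" using dist[of w j] D_sym[of j w] jn
        by (auto simp: B_def blue_less)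
      \<comment> \<open>Nonnegativity of \<open>r\<close>, needed to weaken \<open>r\<close> to
        \<open>3 * r\<close>, comes from the distance between \<open>j\<close> and
        \<open>w\<close>.\<close>
      moreover from this have "0 \<le> r" using D_nonneg[of j w] jn calculation
        by (auto simp: matched_def)
      ultimately show ?thesis by simp
    next
      case False
      then have "F j = {w \<in> matched mate - T. mate w \<in> Suc ` R j}" unfolding F_def by (rule if_not_P)
      then obtain u where u: "w \<in> matched mate" "mate w = Suc u" "u \<in> R j"
        using w by blast
      then have "D u w \<le> 2 * r" "D u j \<le> r" "u < n" "w < n"
        using edge[of w] dist[of u j] by (auto simp: R_def red_less matched_def)
      \<comment> \<open>The matching partner \<open>w\<close> may lie in another cluster:
        \<open>r\<close> leads from the center to the red point \<open>u\<close>, and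
        \<open>2 * r\<close> along the edge.\<close>
      then show ?thesis using D_triangle[of j u w] D_sym[of j u] jn u by simp
    qed
    then show "w \<in> matched mate \<inter> near (3 * r) S" using j by (auto simp: near_def matched_def)
  qed
  \<comment> \<open>Edges charged by blue endpoints lie in \<open>T\<close> and those charged by red
    endpoints do not, so the two kinds never clash; within a kind, the endpoint determines its
    cluster through \<open>assign\<close>.\<close>
  have disj: "F i \<inter> F j = {}" if "i \<noteq> j" for i j
    using that unfolding F_def R_def B_def by auto
  have fin: "finite S" "finite (R j)" "finite (B j)" "finite (F j)" for j
    by (auto simp: S_def R_def B_def F_def)
  have "{i. i < n \<and> assign i \<noteq> 0} \<subseteq> (\<Union>j\<in>S. R j \<union> B j)"
  proof
    fix i assume i: "i \<in> {i. i < n \<and> assign i \<noteq> 0}"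
    then obtain j where j: "assign i = Suc j" using not0_implies_Suc by blast
    then have "j \<in> S" using sol i unfolding solution_def S_def by fastforce
    then show "i \<in> (\<Union>j\<in>S. R j \<union> B j)" using i j color[of i] by (auto simp: R_def B_def red_def blue_def)
  qed
  then have "card {i. i < n \<and> assign i \<noteq> 0} \<le> card (\<Union>j\<in>S. R j \<union> B j)"
    using fin by (intro card_mono) auto
  also have "\<dots> \<le> (\<Sum>j\<in>S. card (R j \<union> B j))" using fin by (intro card_UN_le) auto
  also have "\<dots> \<le> (\<Sum>j\<in>S. 2 * card (F j))"
  proof (rule sum_mono)
    fix j assume j: "j \<in> S"
    show "card (R j \<union> B j) \<le> 2 * card (F j)"
      using card_Un_le[of "R j" "B j"] eq[OF j] F_card[OF j] by linarith
  qed
  also have "\<dots> = 2 * card (\<Union>j\<in>S. F j)"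
    using fin disj by (subst card_UN_disjoint) (auto simp: sum_distrib_left)
  also have "\<dots> \<le> 2 * card (matched mate \<inter> near (3 * r) S)"
    using F_sub by (intro mult_left_mono card_mono) auto
  finally have "n \<le> z + 2 * card (matched mate \<inter> near (3 * r) S)"
    using sol unfolding solution_def by linarith
  moreover have "S \<subseteq> {..<n}" "card S \<le> k" using sol by (auto simp: S_def solution_def)
  ultimately show ?thesis by blast
qed

text \<open>One greedy step either covers a whole ball of the comparison solution \<open>S\<close>, which may then be
  dropped, or covers as many points that are in no ball of \<open>S\<close> as any one of these balls contains.\<close>

lemma greedy_step:
  assumes U: "U \<subseteq> {..<n}" and c: "c < n" and S: "S \<subseteq> {..<n}" and \<rho>: "0 \<le> \<rho>"
    and best: "\<And>s. s < n \<Longrightarrow> card (U \<inter> near \<rho> {s}) \<le> card (U \<inter> near \<rho> {c})"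
  shows "\<exists>S' \<subseteq> {..<n}. card S' \<le> card S - 1 \<and>
    card (U \<inter> near \<rho> S) \<le> card (U \<inter> near (3 * \<rho>) {c}) + card ((U - near (3 * \<rho>) {c}) \<inter> near \<rho> S')"
proof (cases "S = {}")
  case True
  then show ?thesis by (intro exI[of _ "{}"]) (auto simp: near_def)
next
  case False
  let ?G = "U \<inter> near \<rho> {c}" and ?E = "U \<inter> near (3 * \<rho>) {c}"
  have fU: "finite U" using U finite_subset by blast
  have fS: "finite S" using S finite_subset by blast
  have split: "near \<rho> S = near \<rho> {s} \<union> near \<rho> (S - {s})" if "s \<in> S" for s
    using that by (auto simp: near_def)
  have GE: "?G \<subseteq> ?E" using \<rho> by (auto simp: near_def)
  obtain s where s: "s \<in> S" and cov: "card (U \<inter> near \<rho> S) \<le> card ?E + card ((U - near (3 * \<rho>) {c}) \<inter> near \<rho> (S - {s}))"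
  proof (cases "\<exists>s \<in> S. ?G \<inter> near \<rho> {s} \<noteq> {}")
    case True
    then obtain s v where s: "s \<in> S" and v: "v \<in> U" "v < n" "D c v \<le> \<rho>" "D s v \<le> \<rho>"
      using U by (auto simp: near_def)
    \<comment> \<open>The balls around \<open>c\<close> and \<open>s\<close> share the point
      \<open>v\<close>, so the path from \<open>c\<close> over \<open>v\<close> and \<open>s\<close>
      to \<open>w\<close> has three legs of length at most \<rho>. The enlarged ball swallows the
      ball of \<open>s\<close>, which is dropped at no loss.\<close>
    have "near \<rho> {s} \<subseteq> near (3 * \<rho>) {c}"
    proof
      fix w assume "w \<in> near \<rho> {s}"
      then have w: "w < n" "D s w \<le> \<rho>" by (auto simp: near_def)
      have sn: "s < n" using s S by auto
      have "D c w \<le> D c v + D v w" "D v w \<le> D v s + D s w"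
        using D_triangle c v w sn by blast+
      then have "D c w \<le> 3 * \<rho>" using v w D_sym[of v s] sn by linarith
      then show "w \<in> near (3 * \<rho>) {c}" using w by (simp add: near_def)
    qed
    then have "U \<inter> near \<rho> S \<subseteq> ?E \<union> ((U - near (3 * \<rho>) {c}) \<inter> near \<rho> (S - {s}))"
      using split[OF s] by blast
    then have "card (U \<inter> near \<rho> S) \<le> card (?E \<union> ((U - near (3 * \<rho>) {c}) \<inter> near \<rho> (S - {s})))"
      using fU by (intro card_mono) auto
    then show ?thesis using that[OF s] card_Un_le order.trans by blast
  next
    case miss: False
    obtain s where s: "s \<in> S" using False by blast
    \<comment> \<open>No ball of \<open>S\<close> meets \<open>?G\<close>, so any \<open>s\<close>
      may be dropped. Its ball contains at most \<open>card ?G\<close> points of \<open>U\<close>,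
      and \<open>?G\<close> is disjoint from \<open>?rest\<close>: hence \<open>?E\<close> pays both
      for the ball of \<open>s\<close> and for the points of \<open>?rest\<close> that disappear
      with \<open>?E\<close>.\<close>
    let ?rest = "near \<rho> (S - {s})"
    have "U \<inter> near \<rho> S \<subseteq> (U \<inter> near \<rho> {s}) \<union> ((?E \<inter> ?rest) \<union> ((U - near (3 * \<rho>) {c}) \<inter> ?rest))"
      using split[OF s] by blast
    then have "card (U \<inter> near \<rho> S) \<le> card ((U \<inter> near \<rho> {s}) \<union> ((?E \<inter> ?rest) \<union> ((U - near (3 * \<rho>) {c}) \<inter> ?rest)))"
      using fU by (intro card_mono) auto
    also have "\<dots> \<le> card (U \<inter> near \<rho> {s}) + (card (?E \<inter> ?rest) + card ((U - near (3 * \<rho>) {c}) \<inter> ?rest))"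
      by (meson add_left_mono card_Un_le order.trans)
    also have "card (U \<inter> near \<rho> {s}) \<le> card ?G" using best s S by auto
    also have "card ?G + (card (?E \<inter> ?rest) + card ((U - near (3 * \<rho>) {c}) \<inter> ?rest)) =
        card (?G \<union> (?E \<inter> ?rest)) + card ((U - near (3 * \<rho>) {c}) \<inter> ?rest)"
    proof -
      have "?G \<inter> (?E \<inter> ?rest) = {}" using miss by (auto simp: near_def)
      then show ?thesis using fU by (subst card_Un_disjoint) auto
    qed
    also have "card (?G \<union> (?E \<inter> ?rest)) \<le> card ?E"
      using fU GE by (intro card_mono) auto
    finally show ?thesis using that[OF s] by simp
  qed
  have "card (S - {s}) \<le> card S - 1" "S - {s} \<subseteq> {..<n}" using fS s S by (auto simp: card_Diff_singleton)
  then show ?thesis using cov by blast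
qed

text \<open>The last clause is the exchange argument in invariant form: after \<open>j\<close>
  picks, every competitor \<open>S\<close> can be cut down by \<open>j\<close> balls, with the
  points covered so far making up for the loss. It ranges over all \<open>S\<close> because the
  program knows no optimal solution.\<close>

definition greedy ::
  "real \<Rightarrow> (nat \<Rightarrow> nat) \<Rightarrow> (nat \<Rightarrow> nat) \<Rightarrow> (nat \<Rightarrow> nat) \<Rightarrow> nat \<Rightarrow> bool" where
  "greedy r mate cov pick j \<longleftrightarrow> j \<le> n \<and> j \<le> k \<and>
     (\<forall>v<n. cov v \<noteq> 0 \<longrightarrow>
        v \<in> matched mate \<and> cov v \<le> n \<and> pick (cov v - 1) \<noteq> 0 \<and> D (cov v - 1) v \<le> 9 * r) \<and>
     card {c. c < n \<and> pick c \<noteq> 0} \<le> j \<and>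
     (\<forall>S \<subseteq> {..<n}. card S \<le> k \<longrightarrow> (\<exists>S' \<subseteq> {..<n}. card S' \<le> card S - j \<and>
        card (matched mate \<inter> near (3 * r) S) \<le>
          card {v. v < n \<and> cov v \<noteq> 0} + card ({v \<in> matched mate. cov v = 0} \<inter> near (3 * r) S')))"

lemma greedy_init:
  assumes "\<And>v. v < n \<Longrightarrow> cov v = 0" "\<And>v. v < n \<Longrightarrow> pick v = 0"
  shows "greedy r mate cov pick 0"
proof -
  have "{v \<in> matched mate. cov v = 0} = matched mate" "{c. c < n \<and> pick c \<noteq> 0} = {}"
    using assms by (auto simp: matched_def)
  then show ?thesis using assms unfolding greedy_def by (auto intro: exI)
qed

text \<open>This is \<open>greedy_step\<close> with radius \<open>3 * r\<close>: the pick maximizes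
  the gain of the ball of radius \<open>3 * r\<close>, but the ball of radius \<open>9 * r\<close>
  is covered.\<close>

lemma greedy_pick:
  assumes g: "greedy r mate cov pick j" and j: "j < n" "j < k" and c: "c < n" and r: "0 \<le> r"
    and best: "\<And>s. s < n \<Longrightarrow> card ({v \<in> matched mate. cov v = 0} \<inter> near (3 * r) {s}) \<le>
       card ({v \<in> matched mate. cov v = 0} \<inter> near (3 * r) {c})"
    and cov': "\<And>v. v < n \<Longrightarrow>
       cov' v = (if mate v \<noteq> 0 \<and> cov v = 0 \<and> D c v \<le> 9 * r then Suc c else cov v)"
  shows "greedy r mate cov' (pick(c := 1)) (Suc j)"
proof -
  let ?U = "{v \<in> matched mate. cov v = 0}" and ?U' = "{v \<in> matched mate. cov' v = 0}"
  have U': "?U' = ?U - near (3 * (3 * r)) {c}" using cov'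
    by (auto simp: matched_def near_def split: if_splits)
  have eq: "{v. v < n \<and> cov' v \<noteq> 0} = {v. v < n \<and> cov v \<noteq> 0} \<union> (?U \<inter> near (3 * (3 * r)) {c})"
    using cov' by (auto simp: matched_def near_def split: if_splits)
  have W: "card {v. v < n \<and> cov' v \<noteq> 0} =
      card {v. v < n \<and> cov v \<noteq> 0} + card (?U \<inter> near (3 * (3 * r)) {c})"
    unfolding eq by (rule card_Un_disjoint) auto
  \<comment> \<open>Only an inequality is claimed: the same index can be picked again, for instance
    when nothing is left to cover.\<close>
  have "{x. x < n \<and> (pick(c := 1)) x \<noteq> 0} \<subseteq> insert c {x. x < n \<and> pick x \<noteq> 0}" by auto
  then have *: "card {x. x < n \<and> (pick(c := 1)) x \<noteq> 0} \<le> card (insert c {x. x < n \<and> pick x \<noteq> 0})"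
    by (intro card_mono) auto
  have P: "card {x. x < n \<and> (pick(c := 1)) x \<noteq> 0} \<le> Suc j"
  proof -
    have "card {x. x < n \<and> pick x \<noteq> 0} \<le> j" using g unfolding greedy_def by blast
    moreover have "card (insert c {x. x < n \<and> pick x \<noteq> 0}) \<le> Suc (card {x. x < n \<and> pick x \<noteq> 0})"
      by (simp add: card_insert_if)
    ultimately show ?thesis using * by linarith
  qed
  have A: "\<forall>v<n. cov' v \<noteq> 0 \<longrightarrow> v \<in> matched mate \<and> cov' v \<le> n \<and> (pick(c := 1)) (cov' v - 1) \<noteq> 0 \<and>
      D (cov' v - 1) v \<le> 9 * r"
  proof (intro allI impI)
    fix v assume v: "v < n" "cov' v \<noteq> 0"
    show "v \<in> matched mate \<and> cov' v \<le> n \<and> (pick(c := 1)) (cov' v - 1) \<noteq> 0 \<and> D (cov' v - 1) v \<le> 9 * r"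
    proof (cases "mate v \<noteq> 0 \<and> cov v = 0 \<and> D c v \<le> 9 * r")
      case True
      then show ?thesis using v c cov'[of v] by (simp add: matched_def)
    next
      case False
      then have "cov' v = cov v" using cov'[OF v(1)] by simp
      then show ?thesis using g v unfolding greedy_def by simp
    qed
  qed
  have "\<exists>S' \<subseteq> {..<n}. card S' \<le> card S - Suc j \<and> card (matched mate \<inter> near (3 * r) S) \<le>
          card {v. v < n \<and> cov' v \<noteq> 0} + card (?U' \<inter> near (3 * r) S')" if S: "S \<subseteq> {..<n}" "card S \<le> k" for S
  proof -
    obtain S1 where S1: "S1 \<subseteq> {..<n}" "card S1 \<le> card S - j" "card (matched mate \<inter> near (3 * r) S) \<le>
          card {v. v < n \<and> cov v \<noteq> 0} + card (?U \<inter> near (3 * r) S1)"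
      using g S unfolding greedy_def by blast
    have "?U \<subseteq> {..<n}" by (auto simp: matched_def)
    then obtain S2 where "S2 \<subseteq> {..<n}" "card S2 \<le> card S1 - 1" "card (?U \<inter> near (3 * r) S1) \<le>
        card (?U \<inter> near (3 * (3 * r)) {c}) + card ((?U - near (3 * (3 * r)) {c}) \<inter> near (3 * r) S2)"
      using greedy_step[of ?U c S1 "3 * r"] c S1(1) r best by auto
    then show ?thesis using S1 unfolding W U' by (intro exI[of _ S2]) linarith
  qed
  then show ?thesis unfolding greedy_def
    using A P Suc_leI[OF j(1)] Suc_leI[OF j(2)] by (intro conjI allI impI) (assumption | blast)+
qed

text \<open>The loop stops once \<open>j\<close> has reached \<open>n\<close> or \<open>k\<close>,
  and both bound \<open>card S\<close>. The remaining competitor is therefore empty, and the covered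
  points alone match \<open>S\<close>.\<close>

lemma greedy_final:
  assumes g: "greedy r mate cov pick j" and j: "\<not> (j < n \<and> j < k)"
    and S: "S \<subseteq> {..<n}" "card S \<le> k"
  shows "card (matched mate \<inter> near (3 * r) S) \<le> card {v. v < n \<and> cov v \<noteq> 0}"
proof -
  obtain S' where S': "S' \<subseteq> {..<n}" "card S' \<le> card S - j" "card (matched mate \<inter> near (3 * r) S) \<le>
      card {v. v < n \<and> cov v \<noteq> 0} + card ({v \<in> matched mate. cov v = 0} \<inter> near (3 * r) S')"
    using g S unfolding greedy_def by blast
  have "card S \<le> n" using card_mono[OF _ S(1)] by simp
  then have "card S' = 0" using S' S j by auto
  then have "S' = {}" using S'(1) finite_subset by fastforce
  then show ?thesis using S'(3) by (simp add: near_def)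
qed

text \<open>Every cluster is a union of pairs of matched endpoints, so it is balanced because
  \<open>mate\<close> is injective. Each covered blue point accounts for two assigned points, which
  turns \<open>enough\<close> into the outlier bound.\<close>

lemma solution_of_greedy:
  assumes mm: "maximum_matching r mate" and g: "greedy r mate cov pick j" and r: "0 \<le> r"
    and enough: "n \<le> z + 2 * card {v. v < n \<and> cov v \<noteq> 0}"
    and blue: "\<And>v. v \<in> blue \<Longrightarrow> assign v = cov v"
    and red: "\<And>v. v \<in> matched mate \<Longrightarrow> assign (mate v - 1) = cov v"
    and single: "\<And>u. u \<in> red \<Longrightarrow> Suc u \<notin> mate ` matched mate \<Longrightarrow> assign u = 0"
    and center: "\<And>v. v < n \<Longrightarrow> center v = pick v"
  shows "solution (11 * r) center assign"
proof -
  have edge: "\<And>v. v \<in> matched mate \<Longrightarrow> v \<in> local.blue \<and> (\<exists>u. mate v = Suc u \<and> u \<in> local.red \<and> D u v \<le> 2 * r)"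
    and inj: "inj_on mate (matched mate)"
    using mm unfolding maximum_matching_def by blast+
  have cov: "\<And>v. v < n \<Longrightarrow> cov v \<noteq> 0 \<Longrightarrow>
      v \<in> matched mate \<and> cov v \<le> n \<and> pick (cov v - 1) \<noteq> 0 \<and> D (cov v - 1) v \<le> 9 * r"
    using g unfolding greedy_def by blast
  have inj': "inj_on (\<lambda>v. mate v - 1) (matched mate)"
    using inj by (auto simp: inj_on_def matched_def)
  have bl: "{i \<in> local.blue. assign i = Suc j} = {v \<in> matched mate. cov v = Suc j}" for j
    using edge blue cov[OF blue_less] by fastforce
  have rd: "{i \<in> local.red. assign i = Suc j} = (\<lambda>v. mate v - 1) ` {v \<in> matched mate. cov v = Suc j}" for j
  proof
    show "{i \<in> local.red. assign i = Suc j} \<subseteq> (\<lambda>v. mate v - 1) ` {v \<in> matched mate. cov v = Suc j}"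
    proof
      fix u assume u: "u \<in> {i \<in> local.red. assign i = Suc j}"
      then obtain v where "v \<in> matched mate" "Suc u = mate v" using single[of u] by auto
      then show "u \<in> (\<lambda>v. mate v - 1) ` {v \<in> matched mate. cov v = Suc j}"
        using u red[of v] by (intro image_eqI[of _ _ v]) (auto dest: sym)
    qed
    show "(\<lambda>v. mate v - 1) ` {v \<in> matched mate. cov v = Suc j} \<subseteq> {i \<in> local.red. assign i = Suc j}"
      using edge red by fastforce
  qed
  have eq: "card {i \<in> local.red. assign i = Suc j} = card {i \<in> local.blue. assign i = Suc j}" for j
    unfolding bl rd using inj' by (intro card_image) (auto simp: inj_on_def)
  have assigned: "assign i \<le> n \<and> center (assign i - 1) \<noteq> 0 \<and> D i (assign i - 1) \<le> 11 * r"
    if i: "i < n" "assign i \<noteq> 0" for i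
  proof (cases "i \<in> local.blue")
    case True
    then have *: "assign i \<le> n" "pick (assign i - 1) \<noteq> 0" "D (assign i - 1) i \<le> 9 * r"
      using blue[of i] cov[of i] i by auto
    then show ?thesis using i r center[of "assign i - 1"] D_sym[of i "assign i - 1"] by auto
  next
    case False
    then have "i \<in> local.red" using color[of i] i by (auto simp: red_def blue_def)
    then obtain v where v: "v \<in> matched mate" "Suc i = mate v" using single[of i] i by auto
    then have vn: "v < n" and e: "assign i = cov v" "D i v \<le> 2 * r"
      using edge[of v] red[of v] by (auto simp: matched_def dest: sym)
    then have *: "assign i \<le> n" "pick (assign i - 1) \<noteq> 0" "D (assign i - 1) v \<le> 9 * r"
      using cov[of v] i by auto
    then have an: "assign i - 1 < n" using i by auto
    have "D i (assign i - 1) \<le> D i v + D v (assign i - 1)" using D_triangle i vn an by blast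
    then show ?thesis using * e an center D_sym[OF vn an] by auto
  qed
  have "card {i. i < n \<and> assign i \<noteq> 0} = 2 * card {v. v < n \<and> cov v \<noteq> 0}"
  proof -
    let ?V = "{v. v < n \<and> cov v \<noteq> 0}"
    have V: "?V \<subseteq> matched mate" using cov by blast
    have "{i. i < n \<and> assign i \<noteq> 0} = ?V \<union> (\<lambda>v. mate v - 1) ` ?V" (is "?L = ?R")
    proof
      show "?L \<subseteq> ?R"
      proof
        fix i assume i: "i \<in> ?L"
        show "i \<in> ?R"
        proof (cases "i \<in> local.blue")
          case True
          then show ?thesis using blue i by auto
        next
          case False
          then have "i \<in> local.red" using color[of i] i by (auto simp: red_def blue_def)
          then obtain v where v: "v \<in> matched mate" "Suc i = mate v" using single[of i] i by auto
          then have "v \<in> ?V" using i red[of v] by (auto simp: matched_def dest: sym)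
          moreover have "i = mate v - 1" using v(2) by (metis diff_Suc_1)
          ultimately show ?thesis by blast
        qed
      qed
      show "?R \<subseteq> ?L" 
      proof -
        have "i < n \<and> assign i \<noteq> 0 \<and> mate i - 1 < n \<and> assign (mate i - 1) \<noteq> 0" if "i \<in> ?V" for i
        proof -
          have i: "i \<in> matched mate" using that V by blast
          then obtain u where "mate i = Suc u" "u \<in> local.red" "i \<in> local.blue" using edge by blast
          then show ?thesis using that blue[of i] red[OF i] red_less[of u] by auto
        qed
        then show ?thesis by auto
      qed
    qed
    moreover have "?V \<inter> (\<lambda>v. mate v - 1) ` ?V = {}"
    proof -
      have "v \<in> local.blue \<and> mate v - 1 \<in> local.red" if "v \<in> ?V" for v
        using edge[OF subsetD[OF V that]] by auto
      moreover have "local.blue \<inter> local.red = {}" by (auto simp: red_def blue_def)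
      ultimately show ?thesis by blast
    qed
    moreover have "card ((\<lambda>v. mate v - 1) ` ?V) = card ?V"
      using inj_on_subset[OF inj' V] by (rule card_image)
    ultimately show ?thesis by (simp add: card_Un_disjoint)
  qed
  moreover have "{j. j < n \<and> center j \<noteq> 0} = {j. j < n \<and> pick j \<noteq> 0}" using center by auto
  then have "card {j. j < n \<and> center j \<noteq> 0} \<le> k" using g unfolding greedy_def by auto
  ultimately show ?thesis unfolding solution_def using eq assigned enough by auto
qed

end

section \<open>The program\<close>

text \<open>The machine cannot multiply reals, so the multiples of the radius are written as
  sums.\<close>

abbreviation Rad :: rexp where "Rad \<equiv> ReadR ''r'' (Const 0)"
abbreviation Rad2 :: rexp where "Rad2 \<equiv> PlusR Rad Rad"
abbreviation Rad3 :: rexp where "Rad3 \<equiv> PlusR Rad2 Rad"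
abbreviation Rad9 :: rexp where "Rad9 \<equiv> PlusR Rad3 (PlusR Rad3 Rad3)"

text \<open>The cell \<open>arg\<close> holds an index plus one (\<open>0\<close> for none) in \<open>scan_prices\<close> and \<open>place_bid\<close>, but the index
  itself in \<open>best_ball\<close> and \<open>cover_ball\<close>. The entries of \<open>cov\<close> are center indices plus one.\<close>

definition reset_auction :: com where
  "reset_auction = Seq
     (For ''v'' (Seq (Write ''mate'' (Var ''v'') (Const 0)) (Write ''price'' (Var ''v'') (Const 0))))
     (Seq (Assign ''cur'' (Const 0)) (Assign ''next'' (Const 0)))"

text \<open>The start value \<open>n + 1\<close> of \<open>low\<close> is a sentinel: only a price
  of at most \<open>n\<close> can undercut it. If \<open>arg\<close> is still \<open>0\<close> at
  the end, every neighbor costs more than \<open>n\<close> and the bidder gives up.\<close>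

definition scan_prices :: com where
  "scan_prices = Seq (Seq (Assign ''arg'' (Const 0)) (Assign ''low'' (Plus (Var ''n'') (Const 1))))
     (For ''v'' (Cond
        (And (And (Less (Const 1) (Read ''color'' (Var ''v'')))
             (Not (LessR Rad2 (Dist (Minus (Var ''cur'') (Const 1)) (Var ''v'')))))
             (Less (Read ''price'' (Var ''v'')) (Var ''low'')))
        (Seq (Assign ''low'' (Read ''price'' (Var ''v''))) (Assign ''arg'' (Plus (Var ''v'') (Const 1))))
        Skip))"

definition place_bid :: com where
  "place_bid = Cond (Less (Const 0) (Var ''arg''))
     (Seq (Assign ''old'' (Read ''mate'' (Minus (Var ''arg'') (Const 1))))
     (Seq (Write ''mate'' (Minus (Var ''arg'') (Const 1)) (Var ''cur''))
     (Seq (Write ''price'' (Minus (Var ''arg'') (Const 1)) (Plus (Var ''low'') (Const 1)))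
          (Assign ''cur'' (Var ''old'')))))
     (Assign ''cur'' (Const 0))"

definition next_red :: com where
  "next_red = Seq
     (Cond (Less (Read ''color'' (Var ''next'')) (Const 2)) (Assign ''cur'' (Plus (Var ''next'') (Const 1))) Skip)
     (Assign ''next'' (Plus (Var ''next'') (Const 1)))"

text \<open>Tests have no disjunction: the guard says that a red point may still enter or that
  someone is bidding.\<close>

definition run_auction :: com where
  "run_auction = Seq reset_auction
     (Loop (Not (And (Not (Less (Var ''next'') (Var ''n''))) (Not (Less (Const 0) (Var ''cur'')))))
        (Cond (Less (Const 0) (Var ''cur'')) (Seq scan_prices place_bid) next_red))"

definition reset_greedy :: com where
  "reset_greedy = Seq
     (For ''v'' (Seq (Write ''cov'' (Var ''v'') (Const 0)) (Write ''pick'' (Var ''v'') (Const 0))))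
     (Seq (Assign ''covered'' (Const 0)) (Assign ''j'' (Const 0)))"

abbreviation Uncovered :: test where
  "Uncovered \<equiv> And (Less (Const 0) (Read ''mate'' (Var ''v'')))
     (Not (Less (Const 0) (Read ''cov'' (Var ''v''))))"

definition count_ball :: com where
  "count_ball = Seq (Assign ''cnt'' (Const 0))
     (For ''v'' (Cond (And Uncovered (Not (LessR Rad3 (Dist (Var ''c'') (Var ''v'')))))
        (Assign ''cnt'' (Plus (Var ''cnt'') (Const 1))) Skip))"

definition best_ball :: com where
  "best_ball = Seq (Seq (Assign ''most'' (Const 0)) (Assign ''arg'' (Const 0)))
     (For ''c'' (Seq count_ball
        (Cond (Less (Var ''most'') (Var ''cnt''))
           (Seq (Assign ''most'' (Var ''cnt'')) (Assign ''arg'' (Var ''c''))) Skip)))"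

definition cover_ball :: com where
  "cover_ball = Seq (Write ''pick'' (Var ''arg'') (Const 1))
     (For ''v'' (Cond (And Uncovered (Not (LessR Rad9 (Dist (Var ''arg'') (Var ''v'')))))
        (Seq (Write ''cov'' (Var ''v'') (Plus (Var ''arg'') (Const 1)))
             (Assign ''covered'' (Plus (Var ''covered'') (Const 1)))) Skip))"

text \<open>The bound \<open>n\<close> on the rounds does no harm, as no competitor has more than
  \<open>n\<close> centers; it keeps the running time independent of \<open>k\<close>.\<close>

definition run_greedy :: com where
  "run_greedy = Seq reset_greedy
     (Loop (And (Less (Var ''j'') (Var ''n'')) (Less (Var ''j'') (Var ''k'')))
        (Seq best_ball (Seq cover_ball (Assign ''j'' (Plus (Var ''j'') (Const 1))))))"

text \<open>All cells of \<open>center\<close> and \<open>assign\<close> below \<open>n\<close> are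
  rewritten, so nothing of an earlier output survives. Red points are reached only through
  \<open>mate\<close>.\<close>

definition commit :: com where
  "commit = Seq
     (For ''v'' (Seq (Write ''center'' (Var ''v'') (Read ''pick'' (Var ''v''))) (Write ''assign'' (Var ''v'') (Const 0))))
     (Seq
     (For ''v'' (Cond (Less (Const 0) (Read ''mate'' (Var ''v'')))
        (Seq (Write ''assign'' (Var ''v'') (Read ''cov'' (Var ''v'')))
             (Write ''assign'' (Minus (Read ''mate'' (Var ''v'')) (Const 1)) (Read ''cov'' (Var ''v'')))) Skip))
     (Seq (Assign ''found'' (Const 1)) (WriteR ''best'' (Const 0) Rad)))"

definition try_radius :: com where
  "try_radius = Seq run_auction (Seq run_greedy
     (Cond (Less (Plus (Var ''z'') (Plus (Var ''covered'') (Var ''covered''))) (Var ''n'')) Skip commit))"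

text \<open>The radii are tried in input order, without sorting, and no monotonicity of success in
  the radius is used. The diagonal pairs supply the radius \<open>0\<close>.\<close>

definition program :: com where
  "program = For ''a'' (For ''b'' (Seq (WriteR ''r'' (Const 0) (Dist (Var ''a'') (Var ''b'')))
     (Cond (And (Less (Const 0) (Var ''found'')) (Not (LessR Rad (ReadR ''best'' (Const 0)))))
        Skip try_radius)))"

context center_instance
begin

section \<open>Correctness and running time of the auction\<close>

definition input :: "state \<Rightarrow> bool" where
  "input s \<longleftrightarrow> fst s ''n'' 0 = n \<and> fst s ''k'' 0 = k \<and> fst s ''z'' 0 = z \<and> fst s ''color'' = color"

abbreviation auction_state :: "real \<Rightarrow> state \<Rightarrow> bool" where
  "auction_state r s \<equiv> auction r (fst s ''mate'') (fst s ''price'') (fst s ''cur'' 0) (fst s ''next'' 0)"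

lemma wp_reset_auction:
  assumes "input s"
  shows "wp D reset_auction (40 * (n + 1)) (auction_state r) s"
proof -
  let ?I = "\<lambda>j (s :: state). \<forall>v<j. fst s ''mate'' v = 0 \<and> fst s ''price'' v = 0"
  show ?thesis unfolding reset_auction_def
  proof (rule wp_Seq)
    show "wp D (For ''v'' (Seq (Write ''mate'' (Var ''v'') (Const 0)) (Write ''price'' (Var ''v'') (Const 0))))
       (22 * (n + 1) + 3) (?I n) s"
      by (rule wp_For[where n = n and I = ?I and t = 10])
        (use assms in \<open>auto simp: input_def less_Suc_eq intro!: wp_run\<close>)
    fix s' :: state assume "?I n s'"
    then show "wp D (Seq (Assign ''cur'' (Const 0)) (Assign ''next'' (Const 0))) 6 (auction_state r) s'"
      by (intro wp_run) (auto intro!: auction_init)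
  qed simp
qed

definition cheapest :: "real \<Rightarrow> nat \<Rightarrow> nat \<Rightarrow> state \<Rightarrow> bool" where
  "cheapest r u j s \<longleftrightarrow> (\<forall>v \<in> blue. v < j \<longrightarrow> D u v \<le> 2 * r \<longrightarrow> fst s ''low'' 0 \<le> fst s ''price'' v) \<and>
     (if fst s ''arg'' 0 = 0 then fst s ''low'' 0 = n + 1
      else \<exists>v \<in> blue. fst s ''arg'' 0 = Suc v \<and> D u v \<le> 2 * r \<and> fst s ''low'' 0 = fst s ''price'' v \<and>
        fst s ''price'' v \<le> n)"

lemma wp_scan_prices:
  assumes "input s" "snd s ''r'' 0 = r" "fst s ''cur'' 0 = Suc u"
  shows "wp D scan_prices (80 * (n + 1)) (cheapest r u n) s"
  unfolding scan_prices_def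
proof (rule wp_Seq)
  show "wp D (Seq (Assign ''arg'' (Const 0)) (Assign ''low'' (Plus (Var ''n'') (Const 1)))) 10
     (cheapest r u 0) s"
    using assms by (intro wp_run) (auto simp: cheapest_def input_def)
next
  let ?c = "Cond
        (And (And (Less (Const 1) (Read ''color'' (Var ''v'')))
             (Not (LessR Rad2 (Dist (Minus (Var ''cur'') (Const 1)) (Var ''v'')))))
             (Less (Read ''price'' (Var ''v'')) (Var ''low'')))
        (Seq (Assign ''low'' (Read ''price'' (Var ''v''))) (Assign ''arg'' (Plus (Var ''v'') (Const 1))))
        Skip"
  fix s1 assume c: "cheapest r u 0 s1"
    and f: "frame (Seq (Assign ''arg'' (Const 0)) (Assign ''low'' (Plus (Var ''n'') (Const 1)))) s s1"
  show "wp D (For ''v'' ?c) ((n + 1) * 60 + 3) (cheapest r u n) s1"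
  proof (rule wp_For[where n = n and t = 48 and I = "cheapest r u"])
    show "fst s1 ''n'' 0 = n" using f assms(1) by (simp add: frame_def input_def)
  next
    fix j s' assume j: "j < n" and I: "cheapest r u j s'" and f': "frame (For ''v'' ?c) s1 s'" and v: "fst s' ''v'' 0 = j"
    have e: "fst s' ''color'' = color" "snd s' ''r'' 0 = r" "fst s' ''cur'' 0 = Suc u"
      using f f' assms by (simp_all add: frame_def input_def)
    have b: "v \<in> blue \<longleftrightarrow> v < n \<and> 1 < color v" for v
      using color[of v] by (auto simp: blue_def)
    show "wp D ?c 48 (cheapest r u (Suc j)) s'"
    proof (rule wp_run)
      show "cheapest r u (Suc j) (run D ?c s')"
      proof (cases "j \<in> blue \<and> D u j \<le> 2 * r \<and> fst s' ''price'' j < fst s' ''low'' 0")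
        case True
        then have t: "1 < color j" "D u j \<le> 2 * r" "fst s' ''price'' j < fst s' ''low'' 0" by (auto simp: b)
        have "fst s' ''low'' 0 \<le> n + 1" using I by (auto simp: cheapest_def split: if_splits)
        then have "fst s' ''price'' j \<le> n" using t by simp
        moreover have "fst s' ''price'' j \<le> fst s' ''price'' x" if "x \<in> blue" "x < Suc j" "D u x \<le> 2 * r" for x
        proof (cases "x = j")
          case False
          then have "fst s' ''low'' 0 \<le> fst s' ''price'' x" using that I by (auto simp: cheapest_def)
          then show ?thesis using t by simp
        qed simp
        moreover have "fst (run D ?c s') ''low'' 0 = fst s' ''price'' j"
          "fst (run D ?c s') ''arg'' 0 = Suc j" "fst (run D ?c s') ''price'' = fst s' ''price''"
          using t v e by simp_all
        ultimately show ?thesis using True unfolding cheapest_def by (simp del: run.simps)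
      next
        case False
        then have "cheapest r u (Suc j) s'" using I unfolding cheapest_def by (auto simp: less_Suc_eq)
        moreover have "run D ?c s' = s'" using False j v e by (auto simp: b not_less)
        ultimately show ?thesis by (simp only:)
      qed
    qed auto
  qed (use c in \<open>auto simp: cheapest_def\<close>)
qed auto

text \<open>Every bid raises a price, which is worth \<open>2\<close> so that \<open>cur\<close> may stay nonzero; loading the next red
  point pays for making \<open>cur\<close> nonzero.\<close>

definition auction_potential :: "state \<Rightarrow> nat" where
  "auction_potential s = 2 * (n - fst s ''next'' 0) + 2 * (\<Sum>v<n. n + 1 - fst s ''price'' v) +
     (if fst s ''cur'' 0 = 0 then 0 else 1)"

text \<open>The bound is stated with \<open>- 1\<close> so that the \<open>M + 1\<close> of
  \<open>wp_Loop\<close> becomes exactly \<open>4 * (n + 1) * (n + 1)\<close>.\<close>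

lemma auction_potential_le: "auction_potential s \<le> 4 * (n + 1) * (n + 1) - 1"
proof -
  have "(\<Sum>v<n. n + 1 - fst s ''price'' v) \<le> (\<Sum>v<n. n + 1)" by (rule sum_mono) simp
  then have "auction_potential s \<le> 2 * n + 2 * (n * (n + 1)) + 1"
    unfolding auction_potential_def by (intro add_mono mult_left_mono) auto
  then show ?thesis by (simp add: algebra_simps)
qed

lemma wp_place_bid:
  assumes a: "auction r (fst s ''mate'') (fst s ''price'') (Suc u) (fst s ''next'' 0)"
    and cur: "fst s ''cur'' 0 = Suc u" and c: "cheapest r u n s"
  shows "wp D place_bid 40
    (\<lambda>s'. auction_state r s' \<and> auction_potential s' < auction_potential s) s"
proof (rule wp_run)
  let ?s = "run D place_bid s"
  show "auction_state r ?s \<and> auction_potential ?s < auction_potential s"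
  proof (cases "fst s ''arg'' 0 = 0")
    case True
    then have low: "fst s ''low'' 0 = n + 1" using c by (simp add: cheapest_def)
    have "n < fst s ''price'' v" if "v \<in> blue" "D u v \<le> 2 * r" for v
      using c that blue_less[OF that(1)] low unfolding cheapest_def by (metis Suc_eq_plus1 Suc_le_lessD)
    then have "auction r (fst s ''mate'') (fst s ''price'') 0 (fst s ''next'' 0)"
      using auction_give_up[OF a] by blast
    then show ?thesis using True cur by (simp add: place_bid_def auction_potential_def)
  next
    case False
    then obtain v where v: "v \<in> blue" "fst s ''arg'' 0 = Suc v" "D u v \<le> 2 * r"
        "fst s ''low'' 0 = fst s ''price'' v" "fst s ''price'' v \<le> n"
      using c by (auto simp: cheapest_def)
    let ?p = "(fst s ''price'')(v := Suc (fst s ''price'' v))"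
    have vn: "v < n" using v(1) by (rule blue_less)
    have "fst s ''price'' v \<le> fst s ''price'' v'" if "v' \<in> blue" "D u v' \<le> 2 * r" for v'
      using c that blue_less[OF that(1)] v(4) unfolding cheapest_def by metis
    from auction_bid[OF a v(1,3,5) this]
    have b: "auction r ((fst s ''mate'')(v := Suc u)) ?p (fst s ''mate'' v) (fst s ''next'' 0)" .
    \<comment> \<open>Strict despite truncated subtraction, because the price of \<open>v\<close> is
      at most \<open>n\<close> before the bid.\<close>
    have "(\<Sum>w<n. n + 1 - ?p w) < (\<Sum>w<n. n + 1 - fst s ''price'' w)"
      using vn v(5) by (intro sum_strict_mono_ex1) auto
    then show ?thesis using b v cur by (simp add: place_bid_def auction_potential_def)
  qed
qed (simp_all add: place_bid_def)

lemma wp_next_red: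
  assumes "input s" and a: "auction_state r s"
    and cur: "fst s ''cur'' 0 = 0" and u: "fst s ''next'' 0 < n"
  shows "wp D next_red 40
    (\<lambda>s'. auction_state r s' \<and> auction_potential s' < auction_potential s) s"
proof (rule wp_run)
  let ?s = "run D next_red s" and ?u = "fst s ''next'' 0"
  have "auction r (fst s ''mate'') (fst s ''price'') (if color ?u = 1 then Suc ?u else 0) (Suc ?u)"
    using auction_next[OF _ u] a cur by simp
  moreover have "color ?u < 2 \<longleftrightarrow> color ?u = 1" using color[OF u] by auto
  moreover have "fst s ''color'' = color" using assms(1) by (simp add: input_def)
  moreover have "n - ?u = Suc (n - Suc ?u)" using u by simp
  ultimately show "auction_state r ?s \<and> auction_potential ?s < auction_potential s"
    using cur by (simp add: next_red_def auction_potential_def split: if_splits)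
qed (simp_all add: next_red_def)

text \<open>The potential allows quadratically many rounds, and the scan for a cheapest neighbor
  makes each of them linear.\<close>

lemma wp_run_auction:
  assumes s: "input s" "snd s ''r'' 0 = r"
  shows "wp D run_auction (1000 * (n + 1) ^ 3) (\<lambda>s'. maximum_matching r (fst s' ''mate'')) s"
  unfolding run_auction_def
proof (rule wp_Seq)
  show "wp D reset_auction (40 * (n + 1)) (auction_state r) s" using s(1) by (rule wp_reset_auction)
next
  let ?b = "Not (And (Not (Less (Var ''next'') (Var ''n''))) (Not (Less (Const 0) (Var ''cur''))))"
  let ?c = "Cond (Less (Const 0) (Var ''cur'')) (Seq scan_prices place_bid) next_red"
  fix s1 assume a1: "auction_state r s1" and f: "frame reset_auction s s1"
  have s1: "input s1" "snd s1 ''r'' 0 = r"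
    using s f by (simp_all add: frame_def input_def reset_auction_def)
  show "wp D (Loop ?b ?c) (900 * (n + 1) ^ 3) (\<lambda>s'. maximum_matching r (fst s' ''mate'')) s1"
  proof (rule wp_Loop[where I = "auction_state r" and m = auction_potential and t = "130 * (n + 1)"])
    fix s' assume a: "auction_state r s'" and f': "frame ?c s1 s'"
    have s': "input s'" "snd s' ''r'' 0 = r" using s1 f'
      by (simp_all add: frame_def input_def scan_prices_def place_bid_def next_red_def)
    then have n: "fst s' ''n'' 0 = n" by (simp add: input_def)
    {
      assume b: "tval D ?b s'"
      show "wp D ?c (130 * (n + 1)) (\<lambda>s''. auction_state r s'' \<and> auction_potential s'' < auction_potential s') s'"
      proof (rule wp_Cond)
        assume "tval D (Less (Const 0) (Var ''cur'')) s'"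
        then obtain u where u: "fst s' ''cur'' 0 = Suc u" by (auto simp: gr0_conv_Suc)
        show "wp D (Seq scan_prices place_bid) (120 * (n + 1)) (\<lambda>s''. auction_state r s'' \<and> auction_potential s'' < auction_potential s') s'"
        proof (rule wp_Seq)
          show "wp D scan_prices (80 * (n + 1)) (cheapest r u n) s'"
            using s' u by (rule wp_scan_prices)
        next
          fix s2 assume c: "cheapest r u n s2" and f2: "frame scan_prices s' s2"
          have e: "input s2" "fst s2 ''cur'' = fst s' ''cur''" "fst s2 ''next'' = fst s' ''next''"
            "fst s2 ''mate'' = fst s' ''mate''" "fst s2 ''price'' = fst s' ''price''"
            using f2 s'(1) by (simp_all add: frame_def input_def scan_prices_def)
          then have "auction_potential s2 = auction_potential s'" by (simp add: auction_potential_def)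
          then show "wp D place_bid 40 (\<lambda>s''. auction_state r s'' \<and> auction_potential s'' < auction_potential s') s2"
            using wp_place_bid[OF _ _ c] a u e by simp
        qed simp
      next
        assume "\<not> tval D (Less (Const 0) (Var ''cur'')) s'"
        then have "fst s' ''cur'' 0 = 0" "fst s' ''next'' 0 < n" using b n by auto
        from wp_next_red[OF s'(1) a this]
        show "wp D next_red (120 * (n + 1)) (\<lambda>s''. auction_state r s'' \<and> auction_potential s'' < auction_potential s') s'"
          by (rule wp_conseq) auto
      qed simp
    next
      assume b: "\<not> tval D ?b s'"
      then have "fst s' ''cur'' 0 = 0" "\<not> fst s' ''next'' 0 < n" using n by auto
      moreover have "fst s' ''next'' 0 \<le> n" using a by (simp add: auction_def)
      ultimately have "auction r (fst s' ''mate'') (fst s' ''price'') 0 n" using a by simp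
      then show "maximum_matching r (fst s' ''mate'')" by (rule auction_maximum_matching)
    }
  next
    have "4 * (n + 1) * (n + 1) - 1 + 1 = 4 * (n + 1) * (n + 1)" by simp
    moreover have "1 + ttime ?b + 130 * (n + 1) \<le> 150 * (n + 1)" by simp
    ultimately have "(4 * (n + 1) * (n + 1) - 1 + 1) * (1 + ttime ?b + 130 * (n + 1)) \<le>
        4 * (n + 1) * (n + 1) * (150 * (n + 1))"
      by (metis mult_le_mono2)
    also have "4 * x * x * (150 * x) \<le> 900 * x ^ 3" for x :: nat by (simp add: power3_eq_cube)
    finally show "(4 * (n + 1) * (n + 1) - 1 + 1) * (1 + ttime ?b + 130 * (n + 1)) \<le> 900 * (n + 1) ^ 3" .
  qed (rule a1, rule auction_potential_le)
next
  have "n + 1 \<le> (n + 1) ^ 3" by (rule self_le_power) auto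
  then show "40 * (n + 1) + 900 * (n + 1) ^ 3 \<le> 1000 * (n + 1) ^ 3" by simp
qed

section \<open>Correctness and running time of the greedy phase\<close>

abbreviation uncovered :: "state \<Rightarrow> nat set" where
  "uncovered s \<equiv> {v \<in> matched (fst s ''mate''). fst s ''cov'' v = 0}"

lemma card_Int_lessThan_Suc:
  "card (A \<inter> {..<Suc j}) = (if j \<in> A then Suc (card (A \<inter> {..<j})) else card (A \<inter> {..<j}))"
  by (simp add: lessThan_Suc Int_insert_right)

lemma wp_count_ball:
  assumes s: "input s" "snd s ''r'' 0 = r" "fst s ''c'' 0 = c"
  shows "wp D count_ball (60 * (n + 1)) (\<lambda>s'. fst s' ''cnt'' 0 = card (uncovered s \<inter> near (3 * r) {c})) s"
  unfolding count_ball_def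
proof (rule wp_Seq)
  let ?A = "uncovered s \<inter> near (3 * r) {c}"
  let ?I = "\<lambda>j (s' :: state). fst s' ''cnt'' 0 = card (?A \<inter> {..<j})"
  show "wp D (Assign ''cnt'' (Const 0)) 3 (?I 0) s" by (rule wp_run) simp_all
  let ?c = "Cond (And Uncovered (Not (LessR Rad3 (Dist (Var ''c'') (Var ''v'')))))
        (Assign ''cnt'' (Plus (Var ''cnt'') (Const 1))) Skip"
  fix s1 assume I: "?I 0 s1" and f: "frame (Assign ''cnt'' (Const 0)) s s1"
  show "wp D (For ''v'' ?c) ((n + 1) * 57) (\<lambda>s'. fst s' ''cnt'' 0 = card ?A) s1"
  proof (rule wp_For[where n = n and t = 40 and I = ?I])
    show "fst s1 ''n'' 0 = n" using f s(1) by (simp add: frame_def input_def)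
  next
    fix j s' assume j: "j < n" and I: "?I j s'" and f': "frame (For ''v'' ?c) s1 s'" and v: "fst s' ''v'' 0 = j"
    have e: "fst s' ''mate'' = fst s ''mate''" "fst s' ''cov'' = fst s ''cov''" "fst s' ''c'' 0 = c" "snd s' ''r'' 0 = r"
      using f f' s by (simp_all add: frame_def)
    have "j \<in> ?A \<longleftrightarrow> tval D (And Uncovered (Not (LessR Rad3 (Dist (Var ''c'') (Var ''v''))))) s'"
      using j v e by (simp add: matched_def near_def not_less)
    then show "wp D ?c 40 (?I (Suc j)) s'"
      using I by (intro wp_run) (simp_all add: card_Int_lessThan_Suc)
  next
    fix s' assume "?I n s'"
    moreover have "?A \<inter> {..<n} = ?A" by (auto simp: near_def)
    ultimately show "fst s' ''cnt'' 0 = card ?A" by simp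
  qed (use I in simp_all)
qed simp

lemma wp_best_ball:
  assumes s: "input s" "snd s ''r'' 0 = r" and n: "0 < n"
  shows "wp D best_ball (100 * (n + 1) ^ 2) (\<lambda>s'. fst s' ''arg'' 0 < n \<and>
    (\<forall>c<n. card (uncovered s \<inter> near (3 * r) {c}) \<le>
      card (uncovered s \<inter> near (3 * r) {fst s' ''arg'' 0}))) s"
  unfolding best_ball_def
proof (rule wp_Seq)
  let ?f = "\<lambda>c. card (uncovered s \<inter> near (3 * r) {c})"
  let ?I = "\<lambda>j (s' :: state). fst s' ''arg'' 0 < n \<and> fst s' ''most'' 0 \<le> ?f (fst s' ''arg'' 0) \<and>
    (\<forall>c<j. ?f c \<le> fst s' ''most'' 0)"
  let ?c = "Seq count_ball (Cond (Less (Var ''most'') (Var ''cnt''))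
           (Seq (Assign ''most'' (Var ''cnt'')) (Assign ''arg'' (Var ''c''))) Skip)"
  \<comment> \<open>The default center \<open>0\<close> is a valid index because
    \<open>0 < n\<close>; it is kept if no ball contains an uncovered point.\<close>
  show "wp D (Seq (Assign ''most'' (Const 0)) (Assign ''arg'' (Const 0))) 6 (?I 0) s"
    using n by (intro wp_run) simp_all
  fix s1 assume I: "?I 0 s1" and f: "frame (Seq (Assign ''most'' (Const 0)) (Assign ''arg'' (Const 0))) s s1"
  show "wp D (For ''c'' ?c) ((n + 1) * (60 * (n + 1) + 20 + 12) + 3)
    (\<lambda>s'. fst s' ''arg'' 0 < n \<and> (\<forall>c<n. ?f c \<le> ?f (fst s' ''arg'' 0))) s1"
  proof (rule wp_For[where n = n and t = "60 * (n + 1) + 20" and I = ?I])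
    show "fst s1 ''n'' 0 = n" using f s(1) by (simp add: frame_def input_def)
  next
    fix j s' assume j: "j < n" and I: "?I j s'" and f': "frame (For ''c'' ?c) s1 s'" and v: "fst s' ''c'' 0 = j"
    have e: "uncovered s' = uncovered s" "input s'" "snd s' ''r'' 0 = r"
      using f f' s by (simp_all add: frame_def count_ball_def input_def)
    show "wp D ?c (60 * (n + 1) + 20) (?I (Suc j)) s'"
    proof (rule wp_Seq)
      show "wp D count_ball (60 * (n + 1)) (\<lambda>s'. fst s' ''cnt'' 0 = ?f j) s'"
        using wp_count_ball[OF e(2,3) v] unfolding e(1) .
    next
      fix s2 assume c: "fst s2 ''cnt'' 0 = ?f j" and f2: "frame count_ball s' s2"
      have e2: "fst s2 ''arg'' 0 = fst s' ''arg'' 0" "fst s2 ''most'' 0 = fst s' ''most'' 0" "fst s2 ''c'' 0 = j"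
        using f2 v by (simp_all add: frame_def count_ball_def)
      have "?f x \<le> max (fst s' ''most'' 0) (?f j)" if "x < Suc j" for x
        using I that by (cases "x = j") (auto simp: le_max_iff_disj)
      then show "wp D (Cond (Less (Var ''most'') (Var ''cnt''))
           (Seq (Assign ''most'' (Var ''cnt'')) (Assign ''arg'' (Var ''c''))) Skip) 20 (?I (Suc j)) s2"
        using I j c e2 by (intro wp_run) (auto simp: max_def split: if_splits)
    qed simp
  next
    fix s' assume "?I n s'"
    then show "fst s' ''arg'' 0 < n \<and> (\<forall>c<n. ?f c \<le> ?f (fst s' ''arg'' 0))" by (meson order.trans)
  qed (use I in \<open>simp_all add: count_ball_def\<close>)
next
  show "6 + ((n + 1) * (60 * (n + 1) + 20 + 12) + 3) \<le> 100 * (n + 1)\<^sup>2"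
    using n by (simp add: power2_eq_square algebra_simps)
qed

lemma wp_cover_ball:
  assumes s: "input s" "snd s ''r'' 0 = r" and c: "fst s ''arg'' 0 = c" "c < n"
    and w: "fst s ''covered'' 0 = card {v. v < n \<and> fst s ''cov'' v \<noteq> 0}"
  shows "wp D cover_ball (100 * (n + 1)) (\<lambda>s'. fst s' ''pick'' = (fst s ''pick'')(c := 1) \<and>
     (\<forall>v<n. fst s' ''cov'' v = (if fst s ''mate'' v \<noteq> 0 \<and> fst s ''cov'' v = 0 \<and> D c v \<le> 9 * r
        then Suc c else fst s ''cov'' v)) \<and>
     fst s' ''covered'' 0 = card {v. v < n \<and> fst s' ''cov'' v \<noteq> 0}) s"
  unfolding cover_ball_def
proof (rule wp_Seq)
  let ?J = "\<lambda>(s' :: state). fst s' ''pick'' = (fst s ''pick'')(c := 1)"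
  let ?I = "\<lambda>j (s' :: state).
     (\<forall>v<n. fst s' ''cov'' v = (if v < j \<and> fst s ''mate'' v \<noteq> 0 \<and> fst s ''cov'' v = 0 \<and> D c v \<le> 9 * r
        then Suc c else fst s ''cov'' v)) \<and>
     fst s' ''covered'' 0 = card {v. v < n \<and> fst s' ''cov'' v \<noteq> 0}"
  show "wp D (Write ''pick'' (Var ''arg'') (Const 1)) 4 ?J s"
    using c by (intro wp_run) simp_all
  let ?c = "Cond (And Uncovered (Not (LessR Rad9 (Dist (Var ''arg'') (Var ''v'')))))
        (Seq (Write ''cov'' (Var ''v'') (Plus (Var ''arg'') (Const 1)))
             (Assign ''covered'' (Plus (Var ''covered'') (Const 1)))) Skip"
  fix s1 assume J: "?J s1" and f: "frame (Write ''pick'' (Var ''arg'') (Const 1)) s s1"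
  show "wp D (For ''v'' ?c) ((n + 1) * 90 + 3) (\<lambda>s'. ?J s' \<and>
     (\<forall>v<n. fst s' ''cov'' v = (if fst s ''mate'' v \<noteq> 0 \<and> fst s ''cov'' v = 0 \<and> D c v \<le> 9 * r
        then Suc c else fst s ''cov'' v)) \<and>
     fst s' ''covered'' 0 = card {v. v < n \<and> fst s' ''cov'' v \<noteq> 0}) s1"
  proof (rule wp_For[where n = n and t = 78 and I = ?I])
    show "fst s1 ''n'' 0 = n" using f s(1) by (simp add: frame_def input_def)
    show "?I 0 s1" using f w by (simp add: frame_def)
  next
    fix j s' assume j: "j < n" and I: "?I j s'" and f': "frame (For ''v'' ?c) s1 s'" and v: "fst s' ''v'' 0 = j"
    have e: "fst s' ''mate'' = fst s ''mate''" "fst s' ''arg'' 0 = c" "snd s' ''r'' 0 = r"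
      using f f' s c by (simp_all add: frame_def)
    let ?t = "And Uncovered (Not (LessR Rad9 (Dist (Var ''arg'') (Var ''v''))))"
    \<comment> \<open>Only cells below \<open>j\<close> have been rewritten, so the test still reads
      the old value at \<open>j\<close>.\<close>
    have cj: "fst s' ''cov'' j = fst s ''cov'' j" using I j by simp
    have t: "tval D ?t s' \<longleftrightarrow> fst s ''mate'' j \<noteq> 0 \<and> fst s ''cov'' j = 0 \<and> D c j \<le> 9 * r"
      using v e cj by (simp add: not_less)
    show "wp D ?c 78 (?I (Suc j)) s'"
    proof (rule wp_run)
      show "?I (Suc j) (run D ?c s')"
      proof (cases "tval D ?t s'")
        case True
        have r: "fst (run D ?c s') ''cov'' = (fst s' ''cov'')(j := Suc c)"
          "fst (run D ?c s') ''covered'' 0 = Suc (fst s' ''covered'' 0)"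
          using True v e by simp_all
        have "{v. v < n \<and> ((fst s' ''cov'')(j := Suc c)) v \<noteq> 0} = insert j {v. v < n \<and> fst s' ''cov'' v \<noteq> 0}"
          using j by auto
        moreover have "j \<notin> {v. v < n \<and> fst s' ''cov'' v \<noteq> 0}" using True t cj by simp
        ultimately have "card {v. v < n \<and> ((fst s' ''cov'')(j := Suc c)) v \<noteq> 0} = Suc (fst s' ''covered'' 0)"
          using I by simp
        moreover have "\<forall>v<n. ((fst s' ''cov'')(j := Suc c)) v = (if v < Suc j \<and> fst s ''mate'' v \<noteq> 0 \<and>
            fst s ''cov'' v = 0 \<and> D c v \<le> 9 * r then Suc c else fst s ''cov'' v)"
          using I True t by (auto simp: less_Suc_eq)
        ultimately show ?thesis unfolding r by simp
      next
        case False
        then have r: "run D ?c s' = s'" by (simp only: run.simps if_False)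
        have "\<forall>v<n. fst s' ''cov'' v = (if v < Suc j \<and> fst s ''mate'' v \<noteq> 0 \<and>
            fst s ''cov'' v = 0 \<and> D c v \<le> 9 * r then Suc c else fst s ''cov'' v)"
          using I False t by (auto simp: less_Suc_eq)
        then show ?thesis unfolding r using I by blast
      qed
    qed simp_all
  next
    fix s' assume "?I n s'" and "frame (For ''v'' ?c) s1 s'"
    then show "?J s' \<and>
     (\<forall>v<n. fst s' ''cov'' v = (if fst s ''mate'' v \<noteq> 0 \<and> fst s ''cov'' v = 0 \<and> D c v \<le> 9 * r
        then Suc c else fst s ''cov'' v)) \<and>
     fst s' ''covered'' 0 = card {v. v < n \<and> fst s' ''cov'' v \<noteq> 0}"
      using J by (simp add: frame_def)
  qed simp_all
qed simp

definition greedy_state :: "real \<Rightarrow> (nat \<Rightarrow> nat) \<Rightarrow> nat \<Rightarrow> state \<Rightarrow> bool" where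
  "greedy_state r mate j s \<longleftrightarrow> greedy r mate (fst s ''cov'') (fst s ''pick'') j \<and>
     fst s ''covered'' 0 = card {v. v < n \<and> fst s ''cov'' v \<noteq> 0}"

lemma wp_reset_greedy:
  assumes "input s"
  shows "wp D reset_greedy (40 * (n + 1)) (\<lambda>s'. fst s' ''j'' 0 = 0 \<and> greedy_state r mate 0 s') s"
proof -
  let ?I = "\<lambda>j (s :: state). \<forall>v<j. fst s ''cov'' v = 0 \<and> fst s ''pick'' v = 0"
  show ?thesis unfolding reset_greedy_def
  proof (rule wp_Seq)
    show "wp D (For ''v'' (Seq (Write ''cov'' (Var ''v'') (Const 0)) (Write ''pick'' (Var ''v'') (Const 0))))
       (22 * (n + 1) + 3) (?I n) s"
      by (rule wp_For[where n = n and I = ?I and t = 10])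
        (use assms in \<open>auto simp: input_def less_Suc_eq intro!: wp_run\<close>)
    fix s' :: state assume I: "?I n s'"
    then have "{v. v < n \<and> 0 < fst s' ''cov'' v} = {}" by auto
    then show "wp D (Seq (Assign ''covered'' (Const 0)) (Assign ''j'' (Const 0))) 6
        (\<lambda>s'. fst s' ''j'' 0 = 0 \<and> greedy_state r mate 0 s') s'"
      using I by (intro wp_run) (simp_all add: greedy_init greedy_state_def)
  qed simp
qed

lemma wp_run_greedy:
  assumes s: "input s" "snd s ''r'' 0 = r" and r: "0 \<le> r"
  shows "wp D run_greedy (400 * (n + 1) ^ 3)
    (\<lambda>s'. \<exists>j. greedy_state r (fst s ''mate'') j s' \<and> \<not> (j < n \<and> j < k)) s"
  unfolding run_greedy_def
proof (rule wp_Seq)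
  let ?mate = "fst s ''mate''"
  show "wp D reset_greedy (40 * (n + 1)) (\<lambda>s'. fst s' ''j'' 0 = 0 \<and> greedy_state r ?mate 0 s') s"
    using s(1) by (rule wp_reset_greedy)
next
  let ?mate = "fst s ''mate''"
  let ?I = "\<lambda>s'. greedy_state r ?mate (fst s' ''j'' 0) s'"
  let ?b = "And (Less (Var ''j'') (Var ''n'')) (Less (Var ''j'') (Var ''k''))"
  let ?c = "Seq best_ball (Seq cover_ball (Assign ''j'' (Plus (Var ''j'') (Const 1))))"
  let ?t = "300 * (n + 1) ^ 2"
  fix s1 assume I1: "fst s1 ''j'' 0 = 0 \<and> greedy_state r ?mate 0 s1" and f: "frame reset_greedy s s1"
  show "wp D (Loop ?b ?c) (320 * (n + 1) ^ 3)
    (\<lambda>s'. \<exists>j. greedy_state r ?mate j s' \<and> \<not> (j < n \<and> j < k)) s1"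
  proof (rule wp_Loop[where I = ?I and m = "\<lambda>s'. n - fst s' ''j'' 0" and M = n and t = ?t])
    show "?I s1" using I1 by simp
  next
    fix s' assume I: "?I s'" and f': "frame ?c s1 s'"
    have e: "input s'" "snd s' ''r'' 0 = r" "fst s' ''mate'' = ?mate"
      using f f' s by (simp_all add: frame_def input_def reset_greedy_def best_ball_def count_ball_def cover_ball_def)
    {
      assume "tval D ?b s'"
      then have j: "fst s' ''j'' 0 < n" "fst s' ''j'' 0 < k" using e by (simp_all add: input_def)
      then have n: "0 < n" by simp
      show "wp D ?c ?t (\<lambda>s''. ?I s'' \<and> n - fst s'' ''j'' 0 < n - fst s' ''j'' 0) s'"
      proof (rule wp_Seq[OF wp_best_ball[OF e(1,2) n]])
        fix s2
        assume c: "fst s2 ''arg'' 0 < n \<and>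
          (\<forall>c<n. card (uncovered s' \<inter> near (3 * r) {c}) \<le>
             card (uncovered s' \<inter> near (3 * r) {fst s2 ''arg'' 0}))"
          and f2: "frame best_ball s' s2"
        have e2: "input s2" "snd s2 ''r'' 0 = r" "fst s2 ''mate'' = ?mate" "fst s2 ''cov'' = fst s' ''cov''"
            "fst s2 ''pick'' = fst s' ''pick''" "fst s2 ''covered'' = fst s' ''covered''" "fst s2 ''j'' = fst s' ''j''"
          using f2 e by (simp_all add: frame_def input_def best_ball_def count_ball_def)
        have w: "fst s2 ''covered'' 0 = card {v. v < n \<and> fst s2 ''cov'' v \<noteq> 0}"
          using I e2 by (simp add: greedy_state_def)
        show "wp D (Seq cover_ball (Assign ''j'' (Plus (Var ''j'') (Const 1)))) (110 * (n + 1))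
           (\<lambda>s''. ?I s'' \<and> n - fst s'' ''j'' 0 < n - fst s' ''j'' 0) s2"
        proof (rule wp_Seq[OF wp_cover_ball[OF e2(1,2) refl _ w]])
          show "fst s2 ''arg'' 0 < n" using c by simp
          fix s3
          assume P: "fst s3 ''pick'' = (fst s2 ''pick'')(fst s2 ''arg'' 0 := 1) \<and>
             (\<forall>v<n. fst s3 ''cov'' v = (if fst s2 ''mate'' v \<noteq> 0 \<and> fst s2 ''cov'' v = 0 \<and>
                D (fst s2 ''arg'' 0) v \<le> 9 * r then Suc (fst s2 ''arg'' 0) else fst s2 ''cov'' v)) \<and>
             fst s3 ''covered'' 0 = card {v. v < n \<and> fst s3 ''cov'' v \<noteq> 0}"
            and f3: "frame cover_ball s2 s3"
          have g: "greedy r ?mate (fst s' ''cov'') (fst s' ''pick'') (fst s' ''j'' 0)"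
            using I by (simp add: greedy_state_def)
          have "greedy r ?mate (fst s3 ''cov'') ((fst s' ''pick'')(fst s2 ''arg'' 0 := 1)) (Suc (fst s' ''j'' 0))"
          proof (rule greedy_pick[OF g j _ r])
            show "fst s2 ''arg'' 0 < n" using c by simp
          next
            fix x assume "x < n"
            then show "card ({v \<in> matched ?mate. fst s' ''cov'' v = 0} \<inter> near (3 * r) {x})
              \<le> card ({v \<in> matched ?mate. fst s' ''cov'' v = 0} \<inter> near (3 * r) {fst s2 ''arg'' 0})"
              using c unfolding e(3) by blast
          next
            fix v assume "v < n"
            then show "fst s3 ''cov'' v = (if ?mate v \<noteq> 0 \<and> fst s' ''cov'' v = 0 \<and>
                D (fst s2 ''arg'' 0) v \<le> 9 * r then Suc (fst s2 ''arg'' 0) else fst s' ''cov'' v)"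
              using P unfolding e2 by blast
          qed
          moreover have "fst s3 ''j'' = fst s' ''j''" using f3 e2 by (simp add: frame_def cover_ball_def)
          moreover have "n - Suc (fst s' ''j'' 0) < n - fst s' ''j'' 0" using j by simp
          ultimately show "wp D (Assign ''j'' (Plus (Var ''j'') (Const 1))) 6
              (\<lambda>s''. ?I s'' \<and> n - fst s'' ''j'' 0 < n - fst s' ''j'' 0) s3"
            using P e2 by (intro wp_run) (simp_all add: greedy_state_def)
        qed simp
      qed (simp add: power2_eq_square)
    next
      assume "\<not> tval D ?b s'"
      then have "\<not> (fst s' ''j'' 0 < n \<and> fst s' ''j'' 0 < k)" using e by (simp add: input_def)
      then show "\<exists>j. greedy_state r ?mate j s' \<and> \<not> (j < n \<and> j < k)" using I by blast
    }
  next
    have "1 + ttime ?b + ?t \<le> 320 * (n + 1) ^ 2" by (simp add: power2_eq_square)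
    then have "(n + 1) * (1 + ttime ?b + ?t) \<le> (n + 1) * (320 * (n + 1) ^ 2)" by (rule mult_le_mono2)
    then show "(n + 1) * (1 + ttime ?b + ?t) \<le> 320 * (n + 1) ^ 3"
      by (simp only: power3_eq_cube power2_eq_square ac_simps)
  qed simp
next
  have "n + 1 \<le> (n + 1) ^ 3" by (rule self_le_power) auto
  then show "40 * (n + 1) + 320 * (n + 1) ^ 3 \<le> 400 * (n + 1) ^ 3" by simp
qed

text \<open>The second loop writes blue cells directly and red cells through \<open>mate\<close>.
  Injectivity of \<open>mate\<close> and the disjointness of the colors ensure that no later write
  destroys an earlier one.\<close>

lemma wp_commit:
  assumes s: "input s" "snd s ''r'' 0 = r" and mm: "maximum_matching r (fst s ''mate'')"
  shows "wp D commit (150 * (n + 1)) (\<lambda>s'. fst s' ''found'' 0 = 1 \<and> snd s' ''best'' 0 = r \<and>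
     (\<forall>v<n. fst s' ''center'' v = fst s ''pick'' v) \<and>
     (\<forall>v \<in> blue. fst s' ''assign'' v = (if fst s ''mate'' v \<noteq> 0 then fst s ''cov'' v else 0)) \<and>
     (\<forall>v \<in> matched (fst s ''mate''). fst s' ''assign'' (fst s ''mate'' v - 1) = fst s ''cov'' v) \<and>
     (\<forall>u \<in> red. Suc u \<notin> fst s ''mate'' ` matched (fst s ''mate'') \<longrightarrow> fst s' ''assign'' u = 0)) s"
  unfolding commit_def
proof (rule wp_Seq)
  let ?mate = "fst s ''mate''" and ?cov = "fst s ''cov''"
  have edge: "v \<in> blue \<and> (\<exists>u \<in> red. ?mate v = Suc u)" if "v \<in> matched ?mate" for v
    using mm that unfolding maximum_matching_def by blast
  have inj: "inj_on ?mate (matched ?mate)" using mm unfolding maximum_matching_def by blast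
  let ?P = "\<lambda>j (s' :: state). \<forall>v<j. fst s' ''center'' v = fst s ''pick'' v \<and> fst s' ''assign'' v = 0"
  let ?c1 = "Seq (Write ''center'' (Var ''v'') (Read ''pick'' (Var ''v''))) (Write ''assign'' (Var ''v'') (Const 0))"
  let ?c2 = "Cond (Less (Const 0) (Read ''mate'' (Var ''v'')))
        (Seq (Write ''assign'' (Var ''v'') (Read ''cov'' (Var ''v'')))
             (Write ''assign'' (Minus (Read ''mate'' (Var ''v'')) (Const 1)) (Read ''cov'' (Var ''v'')))) Skip"
  show "wp D (For ''v'' ?c1) ((n + 1) * 32 + 3) (?P n) s"
  proof (rule wp_For[where n = n and t = 20 and I = ?P])
    show "fst s ''n'' 0 = n" using s(1) by (simp add: input_def)
  next
    fix j s' assume "?P j s'" "frame (For ''v'' ?c1) s s'" "fst s' ''v'' 0 = j"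
    then show "wp D ?c1 20 (?P (Suc j)) s'"
      by (intro wp_run) (simp_all add: frame_def less_Suc_eq)
  qed simp_all
  let ?I = "\<lambda>j (s' :: state).
     (\<forall>v \<in> blue. fst s' ''assign'' v = (if v < j \<and> ?mate v \<noteq> 0 then ?cov v else 0)) \<and>
     (\<forall>v \<in> matched ?mate. v < j \<longrightarrow> fst s' ''assign'' (?mate v - 1) = ?cov v) \<and>
     (\<forall>u \<in> red. Suc u \<notin> ?mate ` matched ?mate \<longrightarrow> fst s' ''assign'' u = 0)"
  fix s1 assume P: "?P n s1" and f: "frame (For ''v'' ?c1) s s1"
  have s1: "fst s1 ''n'' 0 = n" using f s(1) by (simp add: frame_def input_def)
  have I1: "?I 0 s1" using P by (simp add: red_less blue_less)
  have "wp D (For ''v'' ?c2) ((n + 1) * 42 + 3) (?I n) s1"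
  proof (rule wp_For[where n = n and t = 30 and I = ?I])
    fix j s' assume j: "j < n" and I: "?I j s'" and f': "frame (For ''v'' ?c2) s1 s'" and v: "fst s' ''v'' 0 = j"
    have e: "fst s' ''mate'' = ?mate" "fst s' ''cov'' = ?cov"
      using f f' by (simp_all add: frame_def)
    show "wp D ?c2 30 (?I (Suc j)) s'"
    proof (rule wp_run)
      show "?I (Suc j) (run D ?c2 s')"
      proof (cases "?mate j = 0")
        case True
        then have r: "run D ?c2 s' = s'" using v e by simp
        have "j \<notin> matched ?mate" using True by (simp add: matched_def)
        then show ?thesis unfolding r using I True by (auto simp: less_Suc_eq)
      next
        case False
        then have jm: "j \<in> matched ?mate" using j by (simp add: matched_def)
        then obtain u where jb: "j \<in> blue" and u: "u \<in> red" "?mate j = Suc u" using edge by blast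
        have r: "fst (run D ?c2 s') ''assign'' = (fst s' ''assign'')(j := ?cov j, u := ?cov j)"
          using v e u(2) by simp
        have uj: "v \<noteq> u" if "v \<in> blue" for v using that u by (auto simp: red_def blue_def)
        have ju: "w \<noteq> j" if "w \<in> red" for w using that jb by (auto simp: red_def blue_def)
        have 1: "\<forall>v \<in> blue. ((fst s' ''assign'')(j := ?cov j, u := ?cov j)) v =
            (if v < Suc j \<and> ?mate v \<noteq> 0 then ?cov v else 0)"
          using I False uj by (simp add: less_Suc_eq)
        have 2: "\<forall>v \<in> matched ?mate. v < Suc j \<longrightarrow>
            ((fst s' ''assign'')(j := ?cov j, u := ?cov j)) (?mate v - 1) = ?cov v"
        proof (intro ballI impI)
          fix v assume v: "v \<in> matched ?mate" "v < Suc j"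
          show "((fst s' ''assign'')(j := ?cov j, u := ?cov j)) (?mate v - 1) = ?cov v"
          proof (cases "v = j")
            case True
            then show ?thesis using u by simp
          next
            case False
            then have "?mate v \<noteq> ?mate j" using inj_onD[OF inj _ v(1) jm] by blast
            moreover obtain w where "w \<in> red" "?mate v = Suc w" using edge[OF v(1)] by blast
            ultimately show ?thesis using I v False u ju[of w] by auto
          qed
        qed
        have 3: "((fst s' ''assign'')(j := ?cov j, u := ?cov j)) w = 0"
          if w: "w \<in> red" "Suc w \<notin> ?mate ` matched ?mate" for w
        proof -
          have "w \<noteq> u" using w(2) u(2) jm by (metis imageI)
          then show ?thesis using w ju[OF w(1)] I by simp
        qed
        show ?thesis unfolding r using 1 2 3 by blast
      qed
    qed simp_all
  qed (use s1 I1 in simp_all)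
  then show "wp D (Seq (For ''v'' ?c2) (Seq (Assign ''found'' (Const 1)) (WriteR ''best'' (Const 0) Rad)))
     ((n + 1) * 42 + 12) (\<lambda>s'. fst s' ''found'' 0 = 1 \<and> snd s' ''best'' 0 = r \<and>
     (\<forall>v<n. fst s' ''center'' v = fst s ''pick'' v) \<and>
     (\<forall>v \<in> blue. fst s' ''assign'' v = (if ?mate v \<noteq> 0 then ?cov v else 0)) \<and>
     (\<forall>v \<in> matched ?mate. fst s' ''assign'' (?mate v - 1) = ?cov v) \<and>
     (\<forall>u \<in> red. Suc u \<notin> ?mate ` matched ?mate \<longrightarrow> fst s' ''assign'' u = 0)) s1"
  proof (rule wp_Seq)
    fix s2 assume I: "?I n s2" and f2: "frame (For ''v'' ?c2) s1 s2"
    have e: "snd s2 ''r'' 0 = r" "fst s2 ''center'' = fst s1 ''center''"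
      using f f2 s(2) by (simp_all add: frame_def)
    show "wp D (Seq (Assign ''found'' (Const 1)) (WriteR ''best'' (Const 0) Rad)) 9
     (\<lambda>s'. fst s' ''found'' 0 = 1 \<and> snd s' ''best'' 0 = r \<and>
     (\<forall>v<n. fst s' ''center'' v = fst s ''pick'' v) \<and>
     (\<forall>v \<in> blue. fst s' ''assign'' v = (if ?mate v \<noteq> 0 then ?cov v else 0)) \<and>
     (\<forall>v \<in> matched ?mate. fst s' ''assign'' (?mate v - 1) = ?cov v) \<and>
     (\<forall>u \<in> red. Suc u \<notin> ?mate ` matched ?mate \<longrightarrow> fst s' ''assign'' u = 0)) s2"
      using P I e by (intro wp_run) (simp_all add: blue_less matched_def)
  qed simp
qed simp

section \<open>Search over all radii\<close>

definition solvable :: "real \<Rightarrow> bool" where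
  "solvable \<rho> \<longleftrightarrow> (\<exists>center assign. solution \<rho> center assign)"

text \<open>Rejection is a certificate: a solution of cost \<open>r\<close> would give, by
  \<open>solution_near_matched\<close>, \<open>k\<close> balls containing enough matched blue
  points, and by \<open>greedy_final\<close> the greedy phase covers at least as many. On rejection
  the stored output is untouched; acceptance says nothing about whether \<open>r\<close> is
  solvable.\<close>

lemma wp_try_radius:
  assumes s: "input s" "snd s ''r'' 0 = r" and r: "0 \<le> r"
  shows "wp D try_radius (2000 * (n + 1) ^ 3) (\<lambda>s'.
     fst s' ''found'' 0 = 1 \<and> snd s' ''best'' 0 = r \<and> solution (11 * r) (fst s' ''center'') (fst s' ''assign'') \<or>
     \<not> solvable r \<and> fst s' ''found'' = fst s ''found'' \<and> snd s' ''best'' = snd s ''best'' \<and>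
       fst s' ''center'' = fst s ''center'' \<and> fst s' ''assign'' = fst s ''assign'') s"
  unfolding try_radius_def
proof (rule wp_Seq[OF wp_run_auction[OF s]])
  let ?Q = "\<lambda>s'.
     fst s' ''found'' 0 = 1 \<and> snd s' ''best'' 0 = r \<and> solution (11 * r) (fst s' ''center'') (fst s' ''assign'') \<or>
     \<not> solvable r \<and> fst s' ''found'' = fst s ''found'' \<and> snd s' ''best'' = snd s ''best'' \<and>
       fst s' ''center'' = fst s ''center'' \<and> fst s' ''assign'' = fst s ''assign''"
  let ?t = "Less (Plus (Var ''z'') (Plus (Var ''covered'') (Var ''covered''))) (Var ''n'')"
  note auction_defs = run_auction_def reset_auction_def scan_prices_def place_bid_def next_red_def
  note greedy_defs = run_greedy_def reset_greedy_def best_ball_def count_ball_def cover_ball_def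
  fix s1 assume mm1: "maximum_matching r (fst s1 ''mate'')" and f1: "frame run_auction s s1"
  have s1: "input s1" "snd s1 ''r'' 0 = r" "fst s1 ''found'' = fst s ''found''" "snd s1 ''best'' = snd s ''best''"
      "fst s1 ''center'' = fst s ''center''" "fst s1 ''assign'' = fst s ''assign''"
    using s f1 by (simp_all add: frame_def input_def auction_defs)
  show "wp D (Seq run_greedy (Cond ?t Skip commit)) (700 * (n + 1) ^ 3) ?Q s1"
  proof (rule wp_Seq[OF wp_run_greedy[OF s1(1,2) r]])
    let ?mate = "fst s1 ''mate''"
    fix s2 assume "\<exists>j. greedy_state r ?mate j s2 \<and> \<not> (j < n \<and> j < k)" and f2: "frame run_greedy s1 s2"
    then obtain j where g: "greedy r ?mate (fst s2 ''cov'') (fst s2 ''pick'') j" and j: "\<not> (j < n \<and> j < k)"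
      and w: "fst s2 ''covered'' 0 = card {v. v < n \<and> fst s2 ''cov'' v \<noteq> 0}" by (auto simp: greedy_state_def)
    have s2: "input s2" "snd s2 ''r'' 0 = r" "fst s2 ''found'' = fst s ''found''" "snd s2 ''best'' = snd s ''best''"
        "fst s2 ''center'' = fst s ''center''" "fst s2 ''assign'' = fst s ''assign''" "fst s2 ''mate'' = ?mate"
      using s1 f2 by (simp_all add: frame_def input_def greedy_defs)
    show "wp D (Cond ?t Skip commit) (150 * (n + 1) + 20) ?Q s2"
    proof (rule wp_Cond)
      assume "tval D ?t s2"
      then have few: "z + 2 * card {v. v < n \<and> fst s2 ''cov'' v \<noteq> 0} < n"
        using s2 w by (simp add: input_def)
      have "\<not> solvable r"
      proof
        assume "solvable r"
        then obtain S where "S \<subseteq> {..<n}" "card S \<le> k" "n \<le> z + 2 * card (matched ?mate \<inter> near (3 * r) S)"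
          using solution_near_matched[OF mm1] unfolding solvable_def by blast
        then show False using greedy_final[OF g j, of S] few by linarith
      qed
      then show "wp D Skip (150 * (n + 1)) ?Q s2" using s2 by (intro wp_run) simp_all
    next
      assume "\<not> tval D ?t s2"
      then have enough: "n \<le> z + 2 * card {v. v < n \<and> fst s2 ''cov'' v \<noteq> 0}"
        using s2 w by (simp add: input_def)
      have mm2: "maximum_matching r (fst s2 ''mate'')" using mm1 s2 by simp
      show "wp D commit (150 * (n + 1)) ?Q s2"
      proof (rule wp_conseq[OF wp_commit[OF s2(1,2) mm2]])
        fix s3 :: state
        assume C: "fst s3 ''found'' 0 = 1 \<and> snd s3 ''best'' 0 = r \<and>
         (\<forall>v<n. fst s3 ''center'' v = fst s2 ''pick'' v) \<and>
         (\<forall>v \<in> blue. fst s3 ''assign'' v = (if fst s2 ''mate'' v \<noteq> 0 then fst s2 ''cov'' v else 0)) \<and>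
         (\<forall>v \<in> matched (fst s2 ''mate''). fst s3 ''assign'' (fst s2 ''mate'' v - 1) = fst s2 ''cov'' v) \<and>
         (\<forall>u \<in> red. Suc u \<notin> fst s2 ''mate'' ` matched (fst s2 ''mate'') \<longrightarrow> fst s3 ''assign'' u = 0)"
        have "solution (11 * r) (fst s3 ''center'') (fst s3 ''assign'')"
        proof (rule solution_of_greedy[OF mm1 g r enough])
          fix v assume v: "v \<in> blue"
          have "fst s2 ''cov'' v = 0" if "?mate v = 0"
            using g that blue_less[OF v] unfolding greedy_def matched_def by blast
          then show "fst s3 ''assign'' v = fst s2 ''cov'' v" using C v s2(7) by simp
        qed (use C s2(7) in simp_all)
        then show "?Q s3" using C by blast
      qed simp
    qed simp
  next
    have "150 * (n + 1) + 20 \<le> 170 * (n + 1)" by simp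
    also have "\<dots> \<le> 300 * (n + 1) ^ 3"
      by (intro mult_le_mono self_le_power) auto
    finally show "400 * (n + 1) ^ 3 + (150 * (n + 1) + 20) \<le> 700 * (n + 1) ^ 3" by simp
  qed
qed simp

text \<open>The radius \<open>best\<close> need not be solvable itself. It suffices that it is no
  larger than any solvable radius tried so far, since the stored output is measured against
  \<open>11 * best\<close>.\<close>

definition searched :: "(nat \<times> nat) set \<Rightarrow> state \<Rightarrow> bool" where
  "searched X s \<longleftrightarrow>
     (fst s ''found'' 0 \<noteq> 0 \<longrightarrow> solution (11 * snd s ''best'' 0) (fst s ''center'') (fst s ''assign'')) \<and>
     (\<forall>(i, j) \<in> X. solvable (D i j) \<longrightarrow> fst s ''found'' 0 \<noteq> 0 \<and> snd s ''best'' 0 \<le> D i j)"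

lemma wp_program:
  assumes s: "input s" and found: "fst s ''found'' 0 = 0"
  shows "wp D program (3000 * (n + 1) ^ 5) (searched ({..<n} \<times> {..<n})) s"
  unfolding program_def
proof (rule wp_For[where n = n and I = "\<lambda>a. searched ({..<a} \<times> {..<n})" and t = "2200 * (n + 1) ^ 4"])
  note defs = try_radius_def run_auction_def reset_auction_def scan_prices_def place_bid_def next_red_def
    run_greedy_def reset_greedy_def best_ball_def count_ball_def cover_ball_def commit_def
  let ?c = "Seq (WriteR ''r'' (Const 0) (Dist (Var ''a'') (Var ''b'')))
     (Cond (And (Less (Const 0) (Var ''found'')) (Not (LessR Rad (ReadR ''best'' (Const 0)))))
        Skip try_radius)"
  show "fst s ''n'' 0 = n" using s by (simp add: input_def)
  show "searched ({..<0} \<times> {..<n}) s" using found by (simp add: searched_def)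
  show "''a'' \<notin> nvars (For ''b'' ?c)" "''n'' \<notin> nvars (For ''b'' ?c)" by (simp_all add: defs)
  fix a s1 assume a: "a < n" and I1: "searched ({..<a} \<times> {..<n}) s1"
    and f1: "frame (For ''a'' (For ''b'' ?c)) s s1" and va: "fst s1 ''a'' 0 = a"
  have s1: "input s1" using f1 s by (simp add: frame_def input_def defs)
  let ?X = "\<lambda>b. {..<a} \<times> {..<n} \<union> {a} \<times> {..<b}"
  show "wp D (For ''b'' ?c) (2200 * (n + 1) ^ 4) (searched ({..<Suc a} \<times> {..<n})) s1"
  proof (rule wp_For[where n = n and I = "\<lambda>b. searched (?X b)" and t = "2040 * (n + 1) ^ 3"])
    show "fst s1 ''n'' 0 = n" using s1 by (simp add: input_def)
    show "searched (?X 0) s1" using I1 by simp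
    show "''b'' \<notin> nvars ?c" "''n'' \<notin> nvars ?c" by (simp_all add: defs)
  next
    fix b s2 assume b: "b < n" and I2: "searched (?X b) s2"
      and f2: "frame (For ''b'' ?c) s1 s2" and vb: "fst s2 ''b'' 0 = b"
    have s2: "input s2" "fst s2 ''a'' 0 = a" using f2 s1 va by (simp_all add: frame_def input_def defs)
    let ?w = "WriteR ''r'' (Const 0) (Dist (Var ''a'') (Var ''b''))"
    have X: "?X (Suc b) = insert (a, b) (?X b)" by auto
    show "wp D ?c (2040 * (n + 1) ^ 3) (searched (?X (Suc b))) s2"
    proof (rule wp_Seq)
      show "wp D ?w 10 (\<lambda>s'. snd s' ''r'' 0 = D a b \<and> snd s' ''best'' = snd s2 ''best'') s2"
        using vb s2 by (intro wp_run) simp_all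
    next
      fix s3 assume r: "snd s3 ''r'' 0 = D a b \<and> snd s3 ''best'' = snd s2 ''best''" and f3: "frame ?w s2 s3"
      have s3: "input s3" and e: "fst s3 = fst s2" using f3 s2 by (auto simp: frame_def input_def)
      have I3: "searched (?X b) s3" using I2 r e by (simp add: searched_def)
      let ?t = "And (Less (Const 0) (Var ''found'')) (Not (LessR Rad (ReadR ''best'' (Const 0))))"
      show "wp D (Cond ?t Skip try_radius) (2020 * (n + 1) ^ 3) (searched (?X (Suc b))) s3"
      proof (rule wp_Cond)
        assume "tval D ?t s3"
        then have "fst s3 ''found'' 0 \<noteq> 0 \<and> snd s3 ''best'' 0 \<le> D a b" using r by simp
        then have "searched (?X (Suc b)) s3" using I3 unfolding searched_def X by blast
        then show "wp D Skip (2000 * (n + 1) ^ 3) (searched (?X (Suc b))) s3"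
          by (intro wp_run) simp_all
      next
        assume t: "\<not> tval D ?t s3"
        have "snd s3 ''r'' 0 = D a b" using r by simp
        from wp_try_radius[OF s3 this D_nonneg[OF a b]]
        show "wp D try_radius (2000 * (n + 1) ^ 3) (searched (?X (Suc b))) s3"
        proof (rule wp_conseq)
          fix s4 assume "fst s4 ''found'' 0 = 1 \<and> snd s4 ''best'' 0 = D a b \<and>
              solution (11 * D a b) (fst s4 ''center'') (fst s4 ''assign'') \<or>
            \<not> solvable (D a b) \<and> fst s4 ''found'' = fst s3 ''found'' \<and> snd s4 ''best'' = snd s3 ''best'' \<and>
              fst s4 ''center'' = fst s3 ''center'' \<and> fst s4 ''assign'' = fst s3 ''assign''"
          then show "searched (?X (Suc b)) s4"
          proof
            assume A: "fst s4 ''found'' 0 = 1 \<and> snd s4 ''best'' 0 = D a b \<and>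
              solution (11 * D a b) (fst s4 ''center'') (fst s4 ''assign'')"
            \<comment> \<open>An earlier solvable radius implies that an output was already stored
              with \<open>best\<close> at most that radius; as the skip test failed, the new radius
              is below \<open>best\<close>.\<close>
            have "D a b \<le> D i j" if "(i, j) \<in> ?X b" "solvable (D i j)" for i j
            proof -
              have "fst s3 ''found'' 0 \<noteq> 0 \<and> snd s3 ''best'' 0 \<le> D i j"
                using I3 that unfolding searched_def by blast
              then show ?thesis using t r by simp
            qed
            then show ?thesis using A unfolding searched_def X by auto
          next
            assume "\<not> solvable (D a b) \<and> fst s4 ''found'' = fst s3 ''found'' \<and> snd s4 ''best'' = snd s3 ''best'' \<and>
              fst s4 ''center'' = fst s3 ''center'' \<and> fst s4 ''assign'' = fst s3 ''assign''"
            then show ?thesis using I3 unfolding searched_def X by simp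
          qed
        qed simp
      next
        have "1 \<le> (n + 1) ^ 3" by simp
        moreover have "1 + ttime ?t \<le> 20" by simp
        ultimately show "1 + ttime ?t + 2000 * (n + 1) ^ 3 \<le> 2020 * (n + 1) ^ 3" by linarith
      qed
    next
      have "1 \<le> (n + 1) ^ 3" by simp
      then show "10 + 2020 * (n + 1) ^ 3 \<le> 2040 * (n + 1) ^ 3" by linarith
    qed
  next
    fix s' assume "searched (?X n) s'"
    moreover have "?X n = {..<Suc a} \<times> {..<n}" by auto
    ultimately show "searched ({..<Suc a} \<times> {..<n}) s'" by simp
  next
    have "x * (2040 * x ^ 3 + 12) + 3 \<le> 2200 * x ^ 4" if "1 \<le> x" for x :: nat
    proof -
      have "x \<le> x ^ 4" using that by (intro self_le_power) auto
      moreover have "x ^ 4 = x * x ^ 3" by (simp add: eval_nat_numeral)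
      then have "x * (2040 * x ^ 3 + 12) + 3 = 2040 * x ^ 4 + 12 * x + 3"
        by (simp add: algebra_simps)
      ultimately show ?thesis using that by linarith
    qed
    from this[of "n + 1"] show "(n + 1) * (2040 * (n + 1) ^ 3 + 12) + 3 \<le> 2200 * (n + 1) ^ 4" by linarith
  qed (simp_all add: searched_def)
next
  have "x * (2200 * x ^ 4 + 12) + 3 \<le> 3000 * x ^ 5" if "1 \<le> x" for x :: nat
  proof -
    have "x \<le> x ^ 5" using that by (intro self_le_power) auto
    moreover have "x ^ 5 = x * x ^ 4" by (simp add: eval_nat_numeral)
    then have "x * (2200 * x ^ 4 + 12) + 3 = 2200 * x ^ 5 + 12 * x + 3"
      by (simp add: algebra_simps)
    ultimately show ?thesis using that by linarith
  qed
  from this[of "n + 1"] show "(n + 1) * (2200 * (n + 1) ^ 4 + 12) + 3 \<le> 3000 * (n + 1) ^ 5" by linarith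
qed (simp_all add: searched_def)

lemma solution_mono:
  "solution \<rho> center assign \<Longrightarrow> \<rho> \<le> \<rho>' \<Longrightarrow> solution \<rho>' center assign"
  unfolding solution_def by (meson order.trans)

end

section \<open>From indices to points\<close>

locale listed_instance =
  fixes P :: "'a set" and d :: "'a \<Rightarrow> 'a \<Rightarrow> real" and H1 H2 :: "'a set" and k z :: nat and ps :: "'a list"
  assumes metric: "Metric_space P d" and P: "P = H1 \<union> H2" and disjoint: "H1 \<inter> H2 = {}"
    and ps: "distinct ps" "set ps = P"
begin

abbreviation n :: nat where "n \<equiv> length ps"
text \<open>Taken from the initial memory, so that the equation between whole arrays in
  \<open>input\<close> holds even beyond index \<open>n\<close>.\<close>

definition color :: "nat \<Rightarrow> nat" where "color = fst (init_state ps H1 k z) ''color''"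

lemma color_nth: "i < n \<Longrightarrow> color i = (if ps ! i \<in> H1 then 1 else 2)"
  by (simp add: color_def init_state_def)

sublocale center_instance n k z color "dist_input d ps"
proof
  interpret Metric_space P d by (rule metric)
  fix i j l
  show "i < n \<Longrightarrow> color i = 1 \<or> color i = 2" by (simp add: color_nth)
  show "i < n \<Longrightarrow> j < n \<Longrightarrow> dist_input d ps i j = dist_input d ps j i"
    by (simp add: dist_input_def commute)
  show "i < n \<Longrightarrow> j < n \<Longrightarrow> l < n \<Longrightarrow> dist_input d ps i l \<le> dist_input d ps i j + dist_input d ps j l"
    using ps(2) by (auto simp: dist_input_def intro!: triangle)
  show "i < n \<Longrightarrow> dist_input d ps i i = 0"
    using ps(2) by (auto simp: dist_input_def)
qed

lemma finite_P [simp]: "finite P"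
  using ps(2) by auto

lemma nth_in_P: "i < n \<Longrightarrow> ps ! i \<in> P"
  using ps(2) by auto

lemma nth_eq_iff: "i < n \<Longrightarrow> j < n \<Longrightarrow> ps ! i = ps ! j \<longleftrightarrow> i = j"
  using ps(1) by (rule nth_eq_iff_index_eq)

lemma mem_P_iff: "x \<in> P \<longleftrightarrow> (\<exists>i<n. x = ps ! i)"
  using ps(2) by (metis in_set_conv_nth)

lemma card_nth: "card {i. i < n \<and> Q (ps ! i)} = card {x \<in> P. Q x}"
proof -
  have "{x \<in> P. Q x} = (!) ps ` {i. i < n \<and> Q (ps ! i)}" by (auto simp: mem_P_iff)
  moreover have "inj_on ((!) ps) {i. i < n \<and> Q (ps ! i)}" by (auto simp: inj_on_def nth_eq_iff)
  ultimately show ?thesis by (simp add: card_image)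
qed

lemma red_iff: "i < n \<Longrightarrow> i \<in> red \<longleftrightarrow> ps ! i \<in> H1"
  by (simp add: red_def color_nth)

lemma blue_iff: "i < n \<Longrightarrow> i \<in> blue \<longleftrightarrow> ps ! i \<in> H2"
  using nth_in_P[of i] P disjoint by (auto simp: blue_def color_nth)

lemma card_cluster:
  assumes "\<And>i. i < n \<Longrightarrow> assign i = Suc j \<longleftrightarrow> \<alpha> (ps ! i) = Some c"
  shows "card {i \<in> red. assign i = Suc j} = card (cluster P \<alpha> c \<inter> H1)"
    and "card {i \<in> blue. assign i = Suc j} = card (cluster P \<alpha> c \<inter> H2)"
proof -
  have "{i \<in> red. assign i = Suc j} = {i. i < n \<and> (\<alpha> (ps ! i) = Some c \<and> ps ! i \<in> H1)}"
    using assms red_iff red_less by blast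
  moreover have "{x \<in> P. \<alpha> x = Some c \<and> x \<in> H1} = cluster P \<alpha> c \<inter> H1"
    by (auto simp: cluster_def)
  ultimately show "card {i \<in> red. assign i = Suc j} = card (cluster P \<alpha> c \<inter> H1)"
    using card_nth[of "\<lambda>x. \<alpha> x = Some c \<and> x \<in> H1"] by simp
  have "{i \<in> blue. assign i = Suc j} = {i. i < n \<and> (\<alpha> (ps ! i) = Some c \<and> ps ! i \<in> H2)}"
    using assms blue_iff blue_less by blast
  moreover have "{x \<in> P. \<alpha> x = Some c \<and> x \<in> H2} = cluster P \<alpha> c \<inter> H2"
    by (auto simp: cluster_def)
  ultimately show "card {i \<in> blue. assign i = Suc j} = card (cluster P \<alpha> c \<inter> H2)"
    using card_nth[of "\<lambda>x. \<alpha> x = Some c \<and> x \<in> H2"] by simp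
qed

lemma card_assigned:
  assumes "\<And>i. i < n \<Longrightarrow> assign i = 0 \<longleftrightarrow> \<alpha> (ps ! i) = None"
  shows "n = card (outliers P \<alpha>) + card {i. i < n \<and> assign i \<noteq> 0}"
proof -
  have "{i. i < n \<and> assign i \<noteq> 0} = {i. i < n \<and> \<alpha> (ps ! i) \<noteq> None}"
    using assms by (intro Collect_cong) metis
  then have "card {i. i < n \<and> assign i \<noteq> 0} = card {x \<in> P. \<alpha> x \<noteq> None}"
    using card_nth[of "\<lambda>x. \<alpha> x \<noteq> None"] by (simp only:)
  moreover have "P = outliers P \<alpha> \<union> {x \<in> P. \<alpha> x \<noteq> None}" by (auto simp: outliers_def)
  then have "card P = card (outliers P \<alpha>) + card {x \<in> P. \<alpha> x \<noteq> None}"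
    by (subst card_Un_disjoint[symmetric]) (auto simp: outliers_def)
  moreover have "card P = n" using distinct_card[OF ps(1)] unfolding ps(2) .
  ultimately show ?thesis by linarith
qed

lemma clustering_cost_le_iff:
  "clustering_cost P d \<alpha> \<le> \<rho> \<longleftrightarrow> 0 \<le> \<rho> \<and> (\<forall>x \<in> P. \<alpha> x \<noteq> None \<longrightarrow> d x (the (\<alpha> x)) \<le> \<rho>)"
  unfolding clustering_cost_def by (subst Max_le_iff) (auto simp: outliers_def)

section \<open>Translation between clusterings and index solutions\<close>

lemma solvable_of_fair_clustering:
  assumes fair: "fair_clustering P H1 H2 k z C \<alpha>" and cost: "clustering_cost P d \<alpha> \<le> \<rho>"
  shows "solvable \<rho>"
proof -
  have C: "C \<subseteq> P" "card C \<le> k" and out: "card (outliers P \<alpha>) \<le> z"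
    and bal: "\<And>c. c \<in> C \<Longrightarrow> card (cluster P \<alpha> c \<inter> H1) = card (cluster P \<alpha> c \<inter> H2)"
    using fair unfolding fair_clustering_def by blast+
  have range: "c \<in> C" if "x \<in> P" "\<alpha> x = Some c" for x c
    using fair that unfolding fair_clustering_def by (force simp: image_subset_iff)
  define idx where "idx c = (SOME j. j < n \<and> ps ! j = c)" for c
  have idx: "idx c < n \<and> ps ! idx c = c" if "c \<in> P" for c
    unfolding idx_def using that by (intro someI_ex[of "\<lambda>j. j < n \<and> ps ! j = c"]) (auto simp: mem_P_iff)
  define center :: "nat \<Rightarrow> nat" where "center j = (if ps ! j \<in> C then 1 else 0)" for j
  define assign where "assign i = (case \<alpha> (ps ! i) of None \<Rightarrow> 0 | Some c \<Rightarrow> Suc (idx c))" for i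
  have zero: "assign i = 0 \<longleftrightarrow> \<alpha> (ps ! i) = None" for i
    unfolding assign_def by (cases "\<alpha> (ps ! i)") simp_all
  have some: "assign i = Suc j \<longleftrightarrow> \<alpha> (ps ! i) = Some (ps ! j)" if "i < n" "j < n" for i j
  proof
    assume "assign i = Suc j"
    then obtain c where c: "\<alpha> (ps ! i) = Some c" "j = idx c"
      unfolding assign_def by (cases "\<alpha> (ps ! i)") simp_all
    have "c \<in> P" using range[OF nth_in_P[OF that(1)] c(1)] C(1) by blast
    then show "\<alpha> (ps ! i) = Some (ps ! j)" using idx[of c] c by simp
  next
    assume "\<alpha> (ps ! i) = Some (ps ! j)"
    moreover have "idx (ps ! j) = j"
      using idx[OF nth_in_P[OF that(2)]] nth_eq_iff[OF _ that(2)] by metis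
    ultimately show "assign i = Suc j" by (simp add: assign_def)
  qed
  have "{j. j < n \<and> center j \<noteq> 0} = {j. j < n \<and> ps ! j \<in> C}" by (auto simp: center_def)
  then have "card {j. j < n \<and> center j \<noteq> 0} = card {x \<in> P. x \<in> C}"
    using card_nth[of "\<lambda>x. x \<in> C"] by simp
  also have "{x \<in> P. x \<in> C} = C" using C by auto
  finally have 1: "card {j. j < n \<and> center j \<noteq> 0} \<le> k" using C by simp
  have 2: "assign i \<le> n \<and> center (assign i - 1) \<noteq> 0 \<and> dist_input d ps i (assign i - 1) \<le> \<rho>"
    if i: "i < n" "assign i \<noteq> 0" for i
  proof -
    obtain c where c: "\<alpha> (ps ! i) = Some c" using i(2) unfolding zero by blast
    have "c \<in> C" using range[OF nth_in_P[OF i(1)] c] .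
    moreover have "d (ps ! i) c \<le> \<rho>" using cost c nth_in_P[OF i(1)] unfolding clustering_cost_le_iff by force
    moreover have "idx c < n" "ps ! idx c = c" using idx[of c] C \<open>c \<in> C\<close> by auto
    ultimately show ?thesis using c i by (simp add: assign_def center_def dist_input_def)
  qed
  have 3: "n \<le> z + card {i. i < n \<and> assign i \<noteq> 0}"
  proof -
    have "n = card (outliers P \<alpha>) + card {i. i < n \<and> assign i \<noteq> 0}" by (rule card_assigned) (rule zero)
    then show ?thesis using out by linarith
  qed
  have 4: "card {i \<in> red. assign i = Suc j} = card {i \<in> blue. assign i = Suc j}" if j: "j < n" for j
  proof -
    have "card (cluster P \<alpha> (ps ! j) \<inter> H1) = card (cluster P \<alpha> (ps ! j) \<inter> H2)"
    proof (cases "ps ! j \<in> C")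
      case False
      \<comment> \<open>\<open>solution\<close> asks for balance at all indices, while the
        clustering grants it only at centers; elsewhere the clusters are empty.\<close>
      then have "cluster P \<alpha> (ps ! j) = {}" using range by (auto simp: cluster_def)
      then show ?thesis by simp
    qed (rule bal)
    moreover have "card {i \<in> red. assign i = Suc j} = card (cluster P \<alpha> (ps ! j) \<inter> H1)"
      by (rule card_cluster(1)) (rule some[OF _ j])
    moreover have "card {i \<in> blue. assign i = Suc j} = card (cluster P \<alpha> (ps ! j) \<inter> H2)"
      by (rule card_cluster(2)) (rule some[OF _ j])
    ultimately show ?thesis by (simp only:)
  qed
  have "solution \<rho> center assign" unfolding solution_def using 1 2 3 4 by blast
  then show ?thesis unfolding solvable_def by blast
qed

text \<open>The assumption \<open>0 \<le> \<rho>\<close> serves the case that all points are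
  outliers: the cost is then \<open>0\<close> by convention, while \<open>solution\<close> does not
  constrain \<rho>.\<close>

lemma fair_clustering_of_solution:
  assumes sol: "solution \<rho> (fst s ''center'') (fst s ''assign'')" and \<rho>: "0 \<le> \<rho>"
  shows "\<exists>C \<alpha>. outputs ps s C \<alpha> \<and> fair_clustering P H1 H2 k z C \<alpha> \<and> clustering_cost P d \<alpha> \<le> \<rho>"
proof -
  let ?assign = "fst s ''assign''"
  define C where "C = {ps ! j |j. j < n \<and> fst s ''center'' j \<noteq> 0}"
  define idx where "idx x = (SOME i. i < n \<and> ps ! i = x)" for x
  have idx: "idx (ps ! i) = i" if "i < n" for i
    unfolding idx_def using that by (intro some_equality) (auto simp: nth_eq_iff)
  define \<alpha> where "\<alpha> x = (if ?assign (idx x) = 0 then None else Some (ps ! (?assign (idx x) - 1)))" for x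
  have \<alpha>: "\<alpha> (ps ! i) = (if ?assign i = 0 then None else Some (ps ! (?assign i - 1)))" if "i < n" for i
    using idx[OF that] by (simp add: \<alpha>_def)
  have assign: "?assign i \<le> n" "fst s ''center'' (?assign i - 1) \<noteq> 0" "dist_input d ps i (?assign i - 1) \<le> \<rho>"
    if "i < n" "?assign i \<noteq> 0" for i
    using sol that unfolding solution_def by blast+
  have "outputs ps s C \<alpha>"
    unfolding outputs_def
  proof (intro conjI allI impI)
    show "C = {ps ! j |j. j < n \<and> fst s ''center'' j \<noteq> 0}" by (rule C_def)
    fix i assume i: "i < n"
    show "?assign i = 0 \<and> \<alpha> (ps ! i) = None \<or> (\<exists>j<n. ?assign i = j + 1 \<and> \<alpha> (ps ! i) = Some (ps ! j))"
    proof (cases "?assign i = 0")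
      case False
      then show ?thesis using assign(1)[OF i False] \<alpha>[OF i] by (intro disjI2 exI[of _ "?assign i - 1"]) simp
    qed (simp add: \<alpha>[OF i])
  qed
  moreover have "fair_clustering P H1 H2 k z C \<alpha>"
    unfolding fair_clustering_def
  proof (intro conjI ballI)
    show "C \<subseteq> P" by (auto simp: C_def nth_in_P)
    have "C = (!) ps ` {j. j < n \<and> fst s ''center'' j \<noteq> 0}" by (auto simp: C_def)
    then have "card C \<le> card {j. j < n \<and> fst s ''center'' j \<noteq> 0}" by (simp add: card_image_le)
    then show "card C \<le> k" using sol by (simp add: solution_def)
    show "\<alpha> ` P \<subseteq> insert None (Some ` C)"
    proof
      fix y assume "y \<in> \<alpha> ` P"
      then obtain i where i: "i < n" "y = \<alpha> (ps ! i)" by (auto simp: mem_P_iff)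
      show "y \<in> insert None (Some ` C)"
      proof (cases "?assign i = 0")
        case False
        have "?assign i - 1 < n" using assign(1)[OF i(1) False] False by linarith
        then have "ps ! (?assign i - 1) \<in> C" using assign(2)[OF i(1) False] unfolding C_def by blast
        then show ?thesis using \<alpha>[OF i(1)] i(2) False by simp
      qed (use \<alpha>[OF i(1)] i(2) in simp)
    qed
    have "n = card (outliers P \<alpha>) + card {i. i < n \<and> ?assign i \<noteq> 0}"
      by (rule card_assigned) (simp add: \<alpha>)
    then show "card (outliers P \<alpha>) \<le> z" using sol by (simp add: solution_def)
    fix c assume "c \<in> C"
    then obtain j where j: "j < n" "c = ps ! j" by (auto simp: C_def)
    have "?assign i = Suc j \<longleftrightarrow> \<alpha> (ps ! i) = Some c" if i: "i < n" for i
    proof (cases "?assign i = 0")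
      case False
      then have "?assign i - 1 < n" using assign(1)[OF i] by fastforce
      then have "ps ! (?assign i - 1) = ps ! j \<longleftrightarrow> ?assign i - 1 = j" using j nth_eq_iff by blast
      then show ?thesis using \<alpha>[OF i] False j by auto
    qed (use \<alpha>[OF i] in simp)
    note card = card_cluster[of ?assign j \<alpha> c, OF this]
    show "card (cluster P \<alpha> c \<inter> H1) = card (cluster P \<alpha> c \<inter> H2)"
      using sol j card unfolding solution_def by simp
  qed
  moreover have "clustering_cost P d \<alpha> \<le> \<rho>"
    unfolding clustering_cost_le_iff
  proof (intro conjI ballI impI)
    fix x assume x: "x \<in> P" "\<alpha> x \<noteq> None"
    then obtain i where i: "i < n" "x = ps ! i" by (auto simp: mem_P_iff)
    have a: "?assign i \<noteq> 0" using x(2) \<alpha>[OF i(1)] i(2) by metis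
    have "?assign i - 1 < n" using assign(1)[OF i(1) a] a by linarith
    then show "d x (the (\<alpha> x)) \<le> \<rho>" using assign(3)[OF i(1) a] \<alpha>[OF i(1)] a i by (simp add: dist_input_def)
  qed (rule \<rho>)
  ultimately show ?thesis by blast
qed

text \<open>The third claim guarantees that the search meets the optimal cost: a positive cost is a
  distance between two points, and cost \<open>0\<close> is a diagonal entry of the matrix, which
  requires a point.\<close>

lemma opt_cost_attained:
  assumes "\<exists>C \<alpha>. fair_clustering P H1 H2 k z C \<alpha>"
  shows "0 \<le> opt_cost P d H1 H2 k z" "solvable (opt_cost P d H1 H2 k z)"
    "0 < n \<Longrightarrow> \<exists>i<n. \<exists>j<n. opt_cost P d H1 H2 k z = dist_input d ps i j"
proof -
  have "feasible_costs P d H1 H2 k z \<noteq> {}" using assms by (auto simp: feasible_costs_def)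
  then have "opt_cost P d H1 H2 k z \<in> feasible_costs P d H1 H2 k z"
    unfolding opt_cost_def by (intro Min_in finite_feasible_costs) simp_all
  then obtain C \<alpha> where opt: "opt_cost P d H1 H2 k z = clustering_cost P d \<alpha>"
    and fair: "fair_clustering P H1 H2 k z C \<alpha>" by (auto simp: feasible_costs_def)
  show "0 \<le> opt_cost P d H1 H2 k z" using clustering_cost_le_iff[of \<alpha> "clustering_cost P d \<alpha>"] opt by simp
  show "solvable (opt_cost P d H1 H2 k z)" using solvable_of_fair_clustering[OF fair] opt by simp
  assume n: "0 < n"
  have "clustering_cost P d \<alpha> \<in> insert 0 ((\<lambda>x. d x (the (\<alpha> x))) ` (P - outliers P \<alpha>))"
    unfolding clustering_cost_def by (intro Max_in) auto
  then consider "clustering_cost P d \<alpha> = 0"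
    | x where "x \<in> P - outliers P \<alpha>" "clustering_cost P d \<alpha> = d x (the (\<alpha> x))" by blast
  then show "\<exists>i<n. \<exists>j<n. opt_cost P d H1 H2 k z = dist_input d ps i j"
  proof cases
    case 1
    then show ?thesis using opt D_self[OF n] n by metis
  next
    case 2
    then have x: "x \<in> P" "\<alpha> x \<noteq> None" by (auto simp: outliers_def)
    moreover have "\<alpha> x \<in> insert None (Some ` C)" "C \<subseteq> P" using fair x(1) by (auto simp: fair_clustering_def)
    ultimately have "the (\<alpha> x) \<in> P" by auto
    then obtain i j where "i < n" "x = ps ! i" "j < n" "the (\<alpha> x) = ps ! j"
      using x(1) unfolding mem_P_iff by blast
    then show ?thesis using 2 opt by (metis dist_input_def)
  qed
qed

lemma exec_program:
  "\<exists>t s. exec (dist_input d ps) program (init_state ps H1 k z) t s \<and> t \<le> 3000 * (n + 1) ^ 5 \<and>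
     ((\<exists>C \<alpha>. fair_clustering P H1 H2 k z C \<alpha>) \<longrightarrow>
      (\<exists>C \<alpha>. outputs ps s C \<alpha> \<and> fair_clustering P H1 H2 k z C \<alpha> \<and>
         clustering_cost P d \<alpha> \<le> 11 * opt_cost P d H1 H2 k z))"
proof -
  have "input (init_state ps H1 k z)" "fst (init_state ps H1 k z) ''found'' 0 = 0"
    unfolding input_def by (simp_all add: color_def init_state_def)
  from wp_program[OF this] obtain t s where
    ts: "exec (dist_input d ps) program (init_state ps H1 k z) t s" "t \<le> 3000 * (n + 1) ^ 5"
      "searched ({..<n} \<times> {..<n}) s" by (auto simp: wp_def)
  have "\<exists>C \<alpha>. outputs ps s C \<alpha> \<and> fair_clustering P H1 H2 k z C \<alpha> \<and>
      clustering_cost P d \<alpha> \<le> 11 * opt_cost P d H1 H2 k z"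
    if feasible: "\<exists>C \<alpha>. fair_clustering P H1 H2 k z C \<alpha>"
  proof (rule fair_clustering_of_solution)
    let ?opt = "opt_cost P d H1 H2 k z"
    show "0 \<le> 11 * ?opt" using opt_cost_attained(1)[OF feasible] by simp
    show "solution (11 * ?opt) (fst s ''center'') (fst s ''assign'')"
    proof (cases "n = 0")
      case True
      \<comment> \<open>Without points no radius is tried and nothing is ever stored, but every
        condition on indices is vacuous.\<close>
      then show ?thesis unfolding solution_def using red_less blue_less by fastforce
    next
      case False
      then obtain i j where ij: "i < n" "j < n" "?opt = dist_input d ps i j"
        using opt_cost_attained(3)[OF feasible] by blast
      then have "fst s ''found'' 0 \<noteq> 0 \<and> snd s ''best'' 0 \<le> ?opt"
        using ts(3) opt_cost_attained(2)[OF feasible] unfolding searched_def by auto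
      then show ?thesis using ts(3) unfolding searched_def by (auto intro: solution_mono)
    qed
  qed
  then show ?thesis using ts by blast
qed

end

theorem theorem3p2:
  shows "\<exists>(prog :: com) (T :: nat \<Rightarrow> nat).
    (\<lambda>n. real (T n)) \<in> O(\<lambda>n. real n ^ 5) \<and>
    (\<forall>(P :: 'a set) (d :: 'a \<Rightarrow> 'a \<Rightarrow> real) (H1 :: 'a set) (H2 :: 'a set) (k :: nat) (z :: nat) (ps :: 'a list).
       finite P \<and> Metric_space P d \<and> P = H1 \<union> H2 \<and> H1 \<inter> H2 = {} \<and>
       card H1 \<le> card H2 \<and> card H2 - card H1 \<le> z \<and>
       distinct ps \<and> set ps = P \<longrightarrow>
       (\<exists>(t :: nat) (s :: state).
          exec (dist_input d ps) prog (init_state ps H1 k z) t s \<and> t \<le> T (card P) \<and>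
          ((\<exists>C \<alpha>. fair_clustering P H1 H2 k z C \<alpha>) \<longrightarrow>
           (\<exists>C \<alpha>. outputs ps s C \<alpha> \<and> fair_clustering P H1 H2 k z C \<alpha> \<and>
              clustering_cost P d \<alpha> \<le> 11 * opt_cost P d H1 H2 k z))))"
proof (intro exI[of _ program] exI[of _ "\<lambda>n. 3000 * (n + 1) ^ 5"] conjI allI impI)
  show "(\<lambda>n. real (3000 * (n + 1) ^ 5)) \<in> O(\<lambda>n. real n ^ 5)"
  proof (rule bigoI[of _ "3000 * 2 ^ 5"], rule eventually_sequentiallyI[of 1])
    fix n :: nat assume "1 \<le> n"
    \<comment> \<open>For \<open>n\<close> at least \<open>1\<close>, \<open>n + 1\<close> is at
      most \<open>2 * n\<close>; hence the factor \<open>2 ^ 5\<close>.\<close>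
    then have "(real n + 1) ^ 5 \<le> (2 * real n) ^ 5" by (intro power_mono) auto
    then show "norm (real (3000 * (n + 1) ^ 5)) \<le> 3000 * 2 ^ 5 * norm (real n ^ 5)"
      by (simp add: power_mult_distrib add.commute)
  qed
next
  fix P :: "'a set" and d :: "'a \<Rightarrow> 'a \<Rightarrow> real" and H1 H2 :: "'a set" and k z :: nat and ps :: "'a list"
  assume asm: "finite P \<and> Metric_space P d \<and> P = H1 \<union> H2 \<and> H1 \<inter> H2 = {} \<and>
       card H1 \<le> card H2 \<and> card H2 - card H1 \<le> z \<and> distinct ps \<and> set ps = P"
  then have *: "Metric_space P d" "P = H1 \<union> H2" "H1 \<inter> H2 = {}" "distinct ps" "set ps = P"
    by blast+
  interpret listed_instance P d H1 H2 k z ps using * by (rule listed_instance.intro)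
  have "card P = length ps" using distinct_card[OF *(4)] unfolding *(5) .
  with exec_program show "\<exists>t s. exec (dist_input d ps) program (init_state ps H1 k z) t s \<and> t \<le> 3000 * (card P + 1) ^ 5 \<and>
          ((\<exists>C \<alpha>. fair_clustering P H1 H2 k z C \<alpha>) \<longrightarrow>
           (\<exists>C \<alpha>. outputs ps s C \<alpha> \<and> fair_clustering P H1 H2 k z C \<alpha> \<and>
              clustering_cost P d \<alpha> \<le> 11 * opt_cost P d H1 H2 k z))"
    by (simp only:)
qed

end
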